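(* Let $A\in B_2(L)$. For every complete orthonormal system $\{e_j\}_{j\in\mathbb N}$ in $L$ the partial sums $\Delta_M(A):=\sum_{j=1}^M a(Ae_j)a(\bar e_j)$ converge strongly on $D_1$ to an operator $\Delta(A)$ that does not depend on the choice of the complete orthonormal system, and \[ \|\Delta(A)\Phi\|^2\le\|A\|^2\|N\Phi\|^2+(\|A\|_2^2-\|A\|^2)\|N^{1/2}\Phi\|^2,\qquad\Phi\in D_1 . \] Furthermore, $\Delta(A^T)=\Delta(A)$.
   Context: $L$ is a separable complex Hilbert space with $\dim L=\infty$, scalar product antilinear in the first argument, and a conjugation $J:f\mapsto\bar f$ (antilinear involution with $(\bar f,\bar g)=(g,f)$); for bounded $A$, $\bar A:=JAJ$ and $A^T:=(\bar A)^*$. $B_2(L)$ denotes the Hilbert–Schmidt operators on $L$, $\|A\|$ the operator norm, $\|A\|_2$ the Hilbert–Schmidt norm. $\mathcal F$ carries a Fock representation of the CCR over $L$: on a dense invariant domain $D$ there are operators $a(f),a^\dagger(f)$, linear in $f$, with $[a(f),a(g)]=0=[a^\dagger(f),a^\dagger(g)]$, $[a(f),a^\dagger(g)]=(\bar f,g)\mathrm{id}$, $(a(f)\Phi,\Psi)=(\Phi,a^\dagger(\bar f)\Psi)$, a unit vacuum $\Omega$ with $a(f)\Omega=0$, and $\mathcal F$ is the closure of the span of all vectors $a^\dagger(f_n)\cdots a^\dagger(f_1)\Omega$. $\mathcal F^{(n)}$ is the closure of the span of such vectors with exactly $n$ creation operators; $\mathcal F=\bigoplus_n\mathcal F^{(n)}$,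 $\Phi^{(n)}$ the component in $\mathcal F^{(n)}$. $D_\alpha:=\{\Phi:\sum_n(n+1)^{2\alpha}\|\Phi^{(n)}\|^2<\infty\}$. The operators $a(f),a^\dagger(f)$ extend to $D_{1/2}$ (changing particle number by $\mp1$); these extensions are used. $N$ is the number operator, $(N\Phi)^{(n)}=n\Phi^{(n)}$, and $(N^{1/2}\Phi)^{(n)}=\sqrt n\,\Phi^{(n)}$. *)

theory Defs
  imports "HOL-Analysis.Analysis"
begin

text \<open>A complex Hilbert space is represented by a type of class real_inner and complete_space
  (the underlying real Hilbert space, whose norm is the Hilbert norm) together with a map I
  implementing multiplication by the imaginary unit.\<close>

definition complex_structure :: "('a::real_inner \<Rightarrow> 'a) \<Rightarrow> bool" where
  "complex_structure I \<longleftrightarrow> linear I \<and> (\<forall>x. I (I x) = - x) \<and> (\<forall>x y. inner (I x) (I y) = inner x y)"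

definition cscale :: "('a::real_vector \<Rightarrow> 'a) \<Rightarrow> complex \<Rightarrow> 'a \<Rightarrow> 'a" where
  "cscale I c x = Re c *\<^sub>R x + Im c *\<^sub>R I x"

text \<open>complex scalar product, antilinear in the first argument, with cinner x x = norm x ^ 2\<close>
definition cinner :: "('a::real_inner \<Rightarrow> 'a) \<Rightarrow> 'a \<Rightarrow> 'a \<Rightarrow> complex" where
  "cinner I x y = Complex (inner x y) (inner (I x) y)"

definition cspan :: "('a::real_vector \<Rightarrow> 'a) \<Rightarrow> 'a set \<Rightarrow> 'a set" where
  "cspan I S = {x. \<exists>T c. finite T \<and> T \<subseteq> S \<and> x = (\<Sum>s\<in>T. cscale I (c s) s)}"

definition csubspace :: "('a::real_vector \<Rightarrow> 'a) \<Rightarrow> 'a set \<Rightarrow> bool" where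
  "csubspace I S \<longleftrightarrow> 0 \<in> S \<and> (\<forall>x\<in>S. \<forall>y\<in>S. \<forall>c. cscale I c x + y \<in> S)"

definition clinear :: "('a::real_vector \<Rightarrow> 'a) \<Rightarrow> ('b::real_vector \<Rightarrow> 'b) \<Rightarrow> ('a \<Rightarrow> 'b) \<Rightarrow> bool" where
  "clinear I1 I2 A \<longleftrightarrow> (\<forall>c x y. A (cscale I1 c x + y) = cscale I2 c (A x) + A y)"

definition cbounded :: "('a::real_normed_vector \<Rightarrow> 'a) \<Rightarrow> ('a \<Rightarrow> 'a) \<Rightarrow> bool" where
  "cbounded I A \<longleftrightarrow> clinear I I A \<and> bounded_linear A"

definition infinite_dimensional :: "('a::real_vector \<Rightarrow> 'a) \<Rightarrow> bool" where
  "infinite_dimensional I \<longleftrightarrow> \<not> (\<exists>B. finite B \<and> cspan I B = UNIV)"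

definition orthonormal_system :: "('a::real_inner \<Rightarrow> 'a) \<Rightarrow> (nat \<Rightarrow> 'a) \<Rightarrow> bool" where
  "orthonormal_system I e \<longleftrightarrow> (\<forall>i j. cinner I (e i) (e j) = (if i = j then 1 else 0))"

definition complete_ONS :: "('a::real_inner \<Rightarrow> 'a) \<Rightarrow> (nat \<Rightarrow> 'a) \<Rightarrow> bool" where
  "complete_ONS I e \<longleftrightarrow> orthonormal_system I e \<and> (\<forall>f. (\<forall>j. cinner I (e j) f = 0) \<longrightarrow> f = 0)"

definition conjugation :: "('a::real_inner \<Rightarrow> 'a) \<Rightarrow> ('a \<Rightarrow> 'a) \<Rightarrow> bool" where
  "conjugation I J \<longleftrightarrow> (\<forall>c f g. J (cscale I c f + g) = cscale I (cnj c) (J f) + J g)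
     \<and> (\<forall>f. J (J f) = f) \<and> (\<forall>f g. cinner I (J f) (J g) = cinner I g f)"

text \<open>Hilbert-Schmidt operators and the Hilbert-Schmidt norm (computed in some complete ONS;
  it is independent of the choice)\<close>
definition hilbert_schmidt :: "('a::real_inner \<Rightarrow> 'a) \<Rightarrow> ('a \<Rightarrow> 'a) \<Rightarrow> bool" where
  "hilbert_schmidt I A \<longleftrightarrow> cbounded I A \<and>
     (\<forall>e. complete_ONS I e \<longrightarrow> summable (\<lambda>j. (norm (A (e j)))\<^sup>2))"

definition hs_norm :: "('a::real_inner \<Rightarrow> 'a) \<Rightarrow> ('a \<Rightarrow> 'a) \<Rightarrow> real" where
  "hs_norm I A = sqrt (\<Sum>j. (norm (A ((SOME e. complete_ONS I e) j)))\<^sup>2)"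

definition cadjoint :: "('a::real_inner \<Rightarrow> 'a) \<Rightarrow> ('a \<Rightarrow> 'a) \<Rightarrow> ('a \<Rightarrow> 'a)" where
  "cadjoint I A = (THE B. \<forall>x y. cinner I (B x) y = cinner I x (A y))"

definition conj_op :: "('a \<Rightarrow> 'a) \<Rightarrow> ('a \<Rightarrow> 'a) \<Rightarrow> ('a \<Rightarrow> 'a)" where
  "conj_op J A = J \<circ> A \<circ> J"

definition transpose_op :: "('a::real_inner \<Rightarrow> 'a) \<Rightarrow> ('a \<Rightarrow> 'a) \<Rightarrow> ('a \<Rightarrow> 'a) \<Rightarrow> ('a \<Rightarrow> 'a)" where
  "transpose_op I J A = cadjoint I (conj_op J A)"

definition creation_vectors :: "('l \<Rightarrow> 'f \<Rightarrow> 'f) \<Rightarrow> 'f \<Rightarrow> nat \<Rightarrow> 'f set" where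
  "creation_vectors ad \<Omega> n = {foldr ad fs \<Omega> | fs. length fs = n}"

definition n_particle :: "('f::real_inner \<Rightarrow> 'f) \<Rightarrow> ('l \<Rightarrow> 'f \<Rightarrow> 'f) \<Rightarrow> 'f \<Rightarrow> nat \<Rightarrow> 'f set" where
  "n_particle IF ad \<Omega> n = closure (cspan IF (creation_vectors ad \<Omega> n))"

definition component :: "('f::real_inner \<Rightarrow> 'f) \<Rightarrow> ('l \<Rightarrow> 'f \<Rightarrow> 'f) \<Rightarrow> 'f \<Rightarrow> nat \<Rightarrow> 'f \<Rightarrow> 'f" where
  "component IF ad \<Omega> n \<Phi> = (THE \<psi>. \<psi> \<in> n_particle IF ad \<Omega> n \<and>
      (\<forall>\<Psi>\<in>n_particle IF ad \<Omega> n. cinner IF \<Psi> (\<Phi> - \<psi>) = 0))"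

definition D_alpha :: "('f::real_inner \<Rightarrow> 'f) \<Rightarrow> ('l \<Rightarrow> 'f \<Rightarrow> 'f) \<Rightarrow> 'f \<Rightarrow> real \<Rightarrow> 'f set" where
  "D_alpha IF ad \<Omega> \<alpha> = {\<Phi>. summable (\<lambda>n. (real n + 1) powr (2 * \<alpha>) * (norm (component IF ad \<Omega> n \<Phi>))\<^sup>2)}"

definition number_op :: "('f::real_inner \<Rightarrow> 'f) \<Rightarrow> ('l \<Rightarrow> 'f \<Rightarrow> 'f) \<Rightarrow> 'f \<Rightarrow> 'f \<Rightarrow> 'f" where
  "number_op IF ad \<Omega> \<Phi> = (\<Sum>n. real n *\<^sub>R component IF ad \<Omega> n \<Phi>)"

definition sqrt_number_op :: "('f::real_inner \<Rightarrow> 'f) \<Rightarrow> ('l \<Rightarrow> 'f \<Rightarrow> 'f) \<Rightarrow> 'f \<Rightarrow> 'f \<Rightarrow> 'f" where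
  "sqrt_number_op IF ad \<Omega> \<Phi> = (\<Sum>n. sqrt (real n) *\<^sub>R component IF ad \<Omega> n \<Phi>)"

text \<open>Fock representation of the CCR over (L, IL, J) on (F, IF): annihilation operators a,
  creation operators ad, dense invariant domain D, vacuum Omega. The operators a f, ad f denote
  the extensions to D_(1/2): they are continuous on each F^(n) and act componentwise on D_(1/2).\<close>
definition fock_rep ::
  "('l::real_inner \<Rightarrow> 'l) \<Rightarrow> ('l \<Rightarrow> 'l) \<Rightarrow> ('f::real_inner \<Rightarrow> 'f) \<Rightarrow> 'f set \<Rightarrow>
   ('l \<Rightarrow> 'f \<Rightarrow> 'f) \<Rightarrow> ('l \<Rightarrow> 'f \<Rightarrow> 'f) \<Rightarrow> 'f \<Rightarrow> bool" where
  "fock_rep IL J IF D a ad \<Omega> \<longleftrightarrow>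
     csubspace IF D \<and> closure D = UNIV \<and>
     (\<forall>f. a f ` D \<subseteq> D \<and> ad f ` D \<subseteq> D) \<and>
     (\<forall>f. \<forall>\<Phi>\<in>D. \<forall>\<Psi>\<in>D. \<forall>c. a f (cscale IF c \<Phi> + \<Psi>) = cscale IF c (a f \<Phi>) + a f \<Psi>
                          \<and> ad f (cscale IF c \<Phi> + \<Psi>) = cscale IF c (ad f \<Phi>) + ad f \<Psi>) \<and>
     (\<forall>f g c. \<forall>\<Phi>\<in>D. a (cscale IL c f + g) \<Phi> = cscale IF c (a f \<Phi>) + a g \<Phi>
                    \<and> ad (cscale IL c f + g) \<Phi> = cscale IF c (ad f \<Phi>) + ad g \<Phi>) \<and>
     (\<forall>f g. \<forall>\<Phi>\<in>D. a f (a g \<Phi>) = a g (a f \<Phi>) \<and> ad f (ad g \<Phi>) = ad g (ad f \<Phi>)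
                 \<and> a f (ad g \<Phi>) - ad g (a f \<Phi>) = cscale IF (cinner IL (J f) g) \<Phi>) \<and>
     (\<forall>f. \<forall>\<Phi>\<in>D. \<forall>\<Psi>\<in>D. cinner IF (a f \<Phi>) \<Psi> = cinner IF \<Phi> (ad (J f) \<Psi>)) \<and>
     \<Omega> \<in> D \<and> norm \<Omega> = 1 \<and> (\<forall>f. a f \<Omega> = 0) \<and>
     closure (cspan IF (\<Union>n. creation_vectors ad \<Omega> n)) = UNIV \<and>
     (\<forall>f n. continuous_on (n_particle IF ad \<Omega> n) (a f)
          \<and> continuous_on (n_particle IF ad \<Omega> n) (ad f)) \<and>
     (\<forall>f. \<forall>\<Phi>\<in>D_alpha IF ad \<Omega> (1/2).
          (\<lambda>n. a f (component IF ad \<Omega> n \<Phi>)) sums (a f \<Phi>)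
        \<and> (\<lambda>n. ad f (component IF ad \<Omega> n \<Phi>)) sums (ad f \<Phi>))"

definition Delta_M :: "('l \<Rightarrow> 'l) \<Rightarrow> ('l \<Rightarrow> 'f \<Rightarrow> 'f) \<Rightarrow> ('l \<Rightarrow> 'l) \<Rightarrow> (nat \<Rightarrow> 'l) \<Rightarrow> nat \<Rightarrow> 'f \<Rightarrow> 'f::real_vector" where
  "Delta_M J a A e M \<Phi> = (\<Sum>j<M. a (A (e j)) (a (J (e j)) \<Phi>))"

end

theory Submission
  imports Defs
begin

text \<open>Put \<open>\<Phi>\<^sub>j = a (J e\<^sub>j) \<Phi>\<close> and \<open>g\<^sub>j = A e\<^sub>j\<close>. Moving the creation operators to the right in
  \<open>\<parallel>\<Sum>\<^sub>j a (g\<^sub>j) \<Phi>\<^sub>j\<parallel>\<^sup>2\<close>, dropping the negative commutator term and applying Cauchy--Schwarz bounds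
  it by \<open>\<Sum>\<^sub>j\<^sub>k \<parallel>a (g\<^sub>k) \<Phi>\<^sub>j\<parallel>\<^sup>2 + \<parallel>g\<^sub>k\<parallel>\<^sup>2 \<parallel>\<Phi>\<^sub>j\<parallel>\<^sup>2\<close>. If the vectors \<open>J g\<^sub>k\<close> satisfy a Bessel inequality with
  constant \<open>C\<close>, then \<open>\<Sum>\<^sub>k \<parallel>a (g\<^sub>k) \<Psi>\<parallel>\<^sup>2 \<le> C n \<parallel>\<Psi>\<parallel>\<^sup>2\<close> on \<open>n\<close>-particle vectors; with \<open>C = \<parallel>A\<parallel>\<^sup>2\<close> this gives
  the asserted estimate, and with \<open>C\<close> the tail of the Hilbert--Schmidt series it gives convergence.
  The limit is independent of the basis and symmetric under transposition because on finite
  particle vectors it satisfies \<open>\<Delta> (ad f \<Phi>) = ad f (\<Delta> \<Phi>) + a ((A + A\<^sup>T) f) \<Phi>\<close>.\<close>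

section \<open>Orthogonal series and complex structures\<close>

text \<open>On n-particle vectors the triangle and Cauchy-Schwarz inequalities alone would give the
  factor \<open>n * (n - 1)\<close> times the squared Hilbert-Schmidt norm. The exchange of creation
  operators confines that norm to the lower order: the factor becomes
  \<open>(C * (n - 1) + S) * n\<close>, where \<open>C\<close> is the Bessel constant and
  \<open>S\<close> the sum of the squared norms of the \<open>A e\<^sub>k\<close>. This equals
  \<open>C * n\<^sup>2 + (S - C) * n\<close>, whence the two constants of the estimate. For a late
  block of terms the choice \<open>C = \<parallel>A\<parallel>\<^sup>2\<close> does not become
  small, whereas \<open>C = S\<close> leaves \<open>S * n\<^sup>2\<close>, which does.

  The obstacle is that linearity and the commutation relations are given on \<open>D\<close>, while
  the components of a vector lie in closed spaces on which the operators are only known to be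
  continuous. The algebra is therefore done on the spans \<open>V n\<close>, where each vector
  involves finitely many modes; continuity carries it to the closures, and orthogonality of the
  components to the domain.

  On creation vectors the commutation formula determines the limit recursively, starting from the
  value 0 at the vacuum.\<close>

lemma sums_shift2_le:
  fixes f :: "nat \<Rightarrow> real"
  assumes "f sums s" "\<And>n. f n \<ge> 0" "(\<lambda>n. g n) sums t" "\<And>n. g n \<le> f (n + 2)"
  shows "t \<le> s"
proof -
  have "(\<lambda>n. f (n + 2)) sums (s - (\<Sum>i<2. f i))"
    using assms(1) by (simp only: sums_iff_shift diff_add_cancel)
  then have "t \<le> s - (\<Sum>i<2. f i)" using sums_le[OF assms(4,3)] by simp
  also have "\<dots> \<le> s" using assms(2) by (simp add: sum_nonneg)
  finally show ?thesis .
qed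

lemma orthogonal_sums_norm:
  fixes x :: "nat \<Rightarrow> 'a::real_inner"
  assumes orth: "\<And>i j. i \<noteq> j \<Longrightarrow> inner (x i) (x j) = 0" and "x sums s"
  shows "(\<lambda>i. (norm (x i))\<^sup>2) sums (norm s)\<^sup>2"
proof -
  have "(norm (\<Sum>i<n. x i))\<^sup>2 = (\<Sum>i<n. (norm (x i))\<^sup>2)" for n
    by (rule norm_sum_Pythagorean) (auto simp: pairwise_def orthogonal_def orth)
  moreover have "(\<lambda>n. (norm (\<Sum>i<n. x i))\<^sup>2) \<longlonglongrightarrow> (norm s)\<^sup>2"
    using assms(2) unfolding sums_def by (intro tendsto_intros)
  ultimately show ?thesis by (simp add: sums_def)
qed

lemma orthogonal_summable:
  fixes x :: "nat \<Rightarrow> 'a::{real_inner,complete_space}"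
  assumes orth: "\<And>i j. i \<noteq> j \<Longrightarrow> inner (x i) (x j) = 0"
    and "summable (\<lambda>i. (norm (x i))\<^sup>2)"
  shows "summable x"
proof -
  have *: "norm (sum x {m..<n}) < e" if "norm (\<Sum>i=m..<n. (norm (x i))\<^sup>2) < e\<^sup>2" "e > 0" for m n e
  proof -
    have "(norm (sum x {m..<n}))\<^sup>2 = (\<Sum>i=m..<n. (norm (x i))\<^sup>2)"
      by (rule norm_sum_Pythagorean) (auto simp: pairwise_def orthogonal_def orth)
    then have "(norm (sum x {m..<n}))\<^sup>2 < e\<^sup>2" using that by (simp add: sum_nonneg)
    then show ?thesis using that(2) by (simp add: power_less_imp_less_base)
  qed
  have "Cauchy (\<lambda>n. sum x {..<n})"
  proof (rule CauchyI')
    fix e :: real assume "e > 0"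
    then have "e\<^sup>2 > 0" by simp
    then obtain N where N: "\<And>m n. m \<ge> N \<Longrightarrow> norm (\<Sum>i=m..<n. (norm (x i))\<^sup>2) < e\<^sup>2"
      using assms(2) unfolding summable_Cauchy by blast
    have "dist (sum x {..<m}) (sum x {..<n}) < e" if "m \<ge> N" "n > m" for m n
    proof -
      have "sum x {..<n} - sum x {..<m} = sum x {m..<n}"
        using that by (simp add: lessThan_atLeast0 sum_diff_nat_ivl)
      then show ?thesis using *[OF N[OF that(1)] \<open>e > 0\<close>, of n]
        by (metis dist_norm norm_minus_commute)
    qed
    then show "\<exists>M. \<forall>m\<ge>M. \<forall>n>m. dist (sum x {..<m}) (sum x {..<n}) < e" by blast
  qed
  then show ?thesis by (simp add: summable_iff_convergent Cauchy_convergent)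
qed

locale cspace =
  fixes I :: "'a::real_inner \<Rightarrow> 'a"
  assumes complex_structure: "complex_structure I"
begin

lemma I_linear: "linear I" and I_I: "I (I x) = - x" and inner_I_I: "inner (I x) (I y) = inner x y"
  using complex_structure by (auto simp: complex_structure_def)

lemmas I_simps = I_I linear_add[OF I_linear] linear_diff[OF I_linear] linear_scale[OF I_linear]
  linear_0[OF I_linear]

lemma inner_I_self [simp]: "inner (I x) x = 0"
  using inner_I_I[of "I x" x] by (simp add: I_I inner_commute)

lemma inner_I_right: "inner x (I y) = - inner (I x) y"
  using inner_I_I[of x "I y"] by (simp add: I_I)

text \<open>The real space of the type class and this complex one share their carrier, so complex
  spans and subspaces become available next to the real analysis.\<close>

sublocale C: vector_space "cscale I"
  by unfold_locales (auto simp: cscale_def I_simps algebra_simps)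

lemma cspan_eq: "cspan I S = C.span S"
  unfolding cspan_def C.span_explicit by blast

lemma cscale_of_real [simp]: "cscale I (of_real r) x = r *\<^sub>R x"
  by (simp add: cscale_def)

lemma cscale_of_nat [simp]: "cscale I (of_nat n) x = real n *\<^sub>R x"
  by (simp add: cscale_def)

lemma norm_cscale: "norm (cscale I c x) = cmod c * norm x"
proof -
  have "inner (cscale I c x) (cscale I c x) = (cmod c)\<^sup>2 * inner x x"
    by (simp add: cscale_def inner_add_left inner_add_right inner_I_right inner_I_I I_simps cmod_def)
       (simp add: power2_eq_square algebra_simps)
  then have "(norm (cscale I c x))\<^sup>2 = (cmod c * norm x)\<^sup>2"
    by (simp add: power2_norm_eq_inner power_mult_distrib)
  then show ?thesis by (simp add: power2_eq_iff_nonneg)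
qed

lemma bounded_linear_cscale_right: "bounded_linear (cscale I c)"
proof (rule bounded_linear_intro[where K = "cmod c"])
  show "cscale I c (r *\<^sub>R x) = r *\<^sub>R cscale I c x" for r x
    by (simp add: cscale_def I_simps algebra_simps)
qed (auto simp: C.scale_right_distrib norm_cscale)

lemma inner_cscale_right:
  "inner x (cscale I c y) = Re c * inner x y - Im c * inner (I x) y"
  by (simp add: cscale_def inner_add_right inner_I_right)

lemma Re_cinner [simp]: "Re (cinner I x y) = inner x y"
  by (simp add: cinner_def)

lemma cinner_add_left: "cinner I (x + y) z = cinner I x z + cinner I y z"
  and cinner_add_right: "cinner I z (x + y) = cinner I z x + cinner I z y"
  by (auto simp: cinner_def complex_eq_iff I_simps inner_add_left inner_add_right)

lemma cinner_diff_left: "cinner I (x - y) z = cinner I x z - cinner I y z"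
  and cinner_diff_right: "cinner I z (x - y) = cinner I z x - cinner I z y"
  by (auto simp: cinner_def complex_eq_iff I_simps inner_diff_left inner_diff_right)

lemma cinner_zero [simp]: "cinner I 0 x = 0" "cinner I x 0 = 0"
  by (auto simp: cinner_def complex_eq_iff I_simps)

lemma cinner_commute: "cinner I x y = cnj (cinner I y x)"
  using inner_I_right[of y x] by (simp add: cinner_def complex_eq_iff inner_commute[of x y] inner_commute[of "I x" y])

lemma cinner_cscale_right: "cinner I x (cscale I c y) = c * cinner I x y"
  by (auto simp: cinner_def complex_eq_iff inner_cscale_right I_I algebra_simps)

lemma cinner_cscale_left: "cinner I (cscale I c x) y = cnj c * cinner I x y"
  using cinner_cscale_right[of y c x] cinner_commute by (metis complex_cnj_mult)

lemma cinner_sum_right: "cinner I x (sum f S) = (\<Sum>i\<in>S. cinner I x (f i))"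
  by (induction S rule: infinite_finite_induct) (auto simp: cinner_add_right)

lemma cinner_sum_left: "cinner I (sum f S) x = (\<Sum>i\<in>S. cinner I (f i) x)"
  by (induction S rule: infinite_finite_induct) (auto simp: cinner_add_left)

lemma cinner_self: "cinner I x x = of_real ((norm x)\<^sup>2)"
  by (simp add: cinner_def complex_eq_iff power2_norm_eq_inner)

lemma cinner_self_eq_0 [simp]: "cinner I x x = 0 \<longleftrightarrow> x = 0"
  by (simp add: cinner_self)

lemma norm_eq_1_iff_cinner: "cinner I x x = 1 \<longleftrightarrow> norm x = 1"
  unfolding cinner_self of_real_eq_1_iff by (simp add: power2_eq_1_iff) (smt (verit) norm_ge_zero)

lemma cinner_eqI_left: "(\<And>z. cinner I x z = cinner I y z) \<Longrightarrow> x = y"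
  using cinner_self_eq_0[of "x - y"] by (auto simp: cinner_diff_left)

text \<open>Multiplying \<open>y\<close> by a phase makes the product real and nonnegative, and then
  the real Cauchy-Schwarz inequality applies.\<close>

lemma cmod_cinner_le: "cmod (cinner I x y) \<le> norm x * norm y"
proof (cases "cinner I x y = 0")
  case False
  define c where "c = cnj (cinner I x y) / cmod (cinner I x y)"
  have "cmod (cinner I x y) = Re (c * cinner I x y)"
  proof -
    have "c * cinner I x y = of_real ((cmod (cinner I x y))\<^sup>2) / of_real (cmod (cinner I x y))"
      by (simp add: c_def mult.commute complex_norm_square del: of_real_power)
    then show ?thesis using False by (simp add: power2_eq_square)
  qed
  also have "\<dots> = inner x (cscale I c y)"
    by (simp flip: cinner_cscale_right)
  also have "\<dots> \<le> norm x * norm (cscale I c y)"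
    by (rule norm_cauchy_schwarz)
  also have "\<dots> = norm x * norm y"
    using False by (simp add: norm_cscale c_def norm_divide)
  finally show ?thesis .
qed auto

lemma bounded_linear_cinner_right: "bounded_linear (cinner I x)"
proof (rule bounded_linear_intro[where K = "norm x"])
  show "cinner I x (r *\<^sub>R y) = r *\<^sub>R cinner I x y" for r y
    using cinner_cscale_right[of x "of_real r" y] by (simp add: scaleR_conv_of_real)
  show "cmod (cinner I x y) \<le> norm y * norm x" for y
    using cmod_cinner_le[of x y] by (simp only: mult.commute)
qed (rule cinner_add_right)

lemmas tendsto_cinner_right = bounded_linear.tendsto[OF bounded_linear_cinner_right]

lemma tendsto_cinner_left:
  assumes "(f \<longlongrightarrow> x) G"
  shows "((\<lambda>n. cinner I (f n) y) \<longlongrightarrow> cinner I x y) G"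
proof -
  have "((\<lambda>n. cnj (cinner I y (f n))) \<longlongrightarrow> cnj (cinner I y x)) G"
    by (intro tendsto_cnj tendsto_cinner_right assms)
  then show ?thesis unfolding cinner_commute[of "f _" y] cinner_commute[of x y] .
qed

subsection \<open>Orthonormal sets and systems\<close>

definition orthonormal_set :: "'a set \<Rightarrow> bool" where
  "orthonormal_set B \<longleftrightarrow> (\<forall>x\<in>B. \<forall>y\<in>B. cinner I x y = (if x = y then 1 else 0))"

text \<open>For finite orthonormal \<open>B\<close> this is membership in the span of
  \<open>B\<close>, in the form that provides coefficients for operator identities.\<close>

definition expands :: "'a set \<Rightarrow> 'a \<Rightarrow> bool" where
  "expands B f \<longleftrightarrow> f = (\<Sum>b\<in>B. cscale I (cinner I b f) b)"

text \<open>Vectors of the algebraic particle spaces involve finitely many one-particle vectors; a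
  common orthonormal expansion of these reduces the later identities to finite sums.\<close>

lemma gram_schmidt:
  assumes "finite S"
  obtains B where "finite B" "orthonormal_set B" "\<And>f. f \<in> S \<Longrightarrow> expands B f"
proof -
  from assms have "\<exists>B. finite B \<and> orthonormal_set B \<and> (\<forall>f\<in>S. expands B f)"
  proof (induction S rule: finite_induct)
    case empty
    show ?case by (rule exI[of _ "{}"]) (simp add: orthonormal_set_def)
  next
    case (insert f S)
    then obtain B where B: "finite B" "orthonormal_set B" "\<And>f. f \<in> S \<Longrightarrow> expands B f" by blast
    define r where "r = f - (\<Sum>b\<in>B. cscale I (cinner I b f) b)"
    have r: "cinner I b r = 0" if "b \<in> B" for b
    proof -
      have "cinner I b (\<Sum>b\<in>B. cscale I (cinner I b f) b)
          = (\<Sum>b'\<in>B. if b' = b then cinner I b' f else 0)"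
        unfolding cinner_sum_right using B(2) that
        by (intro sum.cong) (auto simp: cinner_cscale_right orthonormal_set_def)
      then show ?thesis using B(1) that by (simp add: r_def cinner_diff_right)
    qed
    show ?case
    proof (cases "r = 0")
      case True
      then have "expands B f" by (simp add: r_def expands_def)
      then show ?thesis using B by blast
    next
      case False
      define u where "u = cscale I (of_real (1 / norm r)) r"
      have bu: "cinner I b u = 0" if "b \<in> B" for b
        unfolding u_def cinner_cscale_right using r[OF that] by simp
      then have ub: "cinner I u b = 0" if "b \<in> B" for b
        using that cinner_commute[of u b] by simp
      have uu: "cinner I u u = 1"
        using False unfolding u_def cinner_self norm_cscale by (simp add: norm_divide)
      then have nB: "u \<notin> B" using bu by force
      \<comment> \<open>\<open>f\<close> and the residual \<open>r\<close> differ by a vector in the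
        span of \<open>B\<close>, which is orthogonal to \<open>u\<close>. The new coefficient is
        thus \<open>norm r\<close> and restores exactly \<open>r\<close>.\<close>
      have "cinner I u f = cinner I u r"
        using ub by (simp add: r_def cinner_diff_right cinner_sum_right cinner_cscale_right)
      also have "\<dots> = of_real (norm r)"
        unfolding u_def cinner_cscale_left cinner_self using False by (simp add: power2_eq_square)
      finally have "cscale I (cinner I u f) u = r" using False by (simp add: u_def)
      then have "expands (insert u B) f"
        using B(1) nB by (simp add: expands_def r_def)
      \<comment> \<open>Earlier vectors lie in the span of \<open>B\<close>, so they only gain a
        zero coefficient.\<close>
      moreover have "expands (insert u B) g" if "g \<in> S" for g
      proof -
        have g: "g = (\<Sum>b\<in>B. cscale I (cinner I b g) b)" using B(3)[OF that] by (simp add: expands_def)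
        have "cinner I u g = 0"
          by (subst g) (simp add: cinner_sum_right cinner_cscale_right ub)
        then show ?thesis using B(1) nB g by (simp add: expands_def)
      qed
      moreover have "orthonormal_set (insert u B)"
        using B(2) uu bu ub nB by (auto simp: orthonormal_set_def)
      ultimately show ?thesis using B(1) by (intro exI[of _ "insert u B"]) auto
    qed
  qed
  then show ?thesis using that by blast
qed

lemma norm_sum_orthonormal:
  assumes "finite K" "\<And>i j. i \<in> K \<Longrightarrow> j \<in> K \<Longrightarrow> cinner I (e i) (e j) = (if i = j then 1 else 0)"
  shows "(norm (\<Sum>i\<in>K. cscale I (c i) (e i)))\<^sup>2 = (\<Sum>i\<in>K. (cmod (c i))\<^sup>2)"
proof -
  have "(norm (e i))\<^sup>2 = 1" if "i \<in> K" for i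
    using assms(2)[OF that that] by (simp add: norm_eq_1_iff_cinner)
  moreover have "pairwise (\<lambda>i j. orthogonal (cscale I (c i) (e i)) (cscale I (c j) (e j))) K"
  proof (unfold pairwise_def orthogonal_def, intro ballI impI)
    fix i j assume "i \<in> K" "j \<in> K" "i \<noteq> j"
    then have "cinner I (cscale I (c i) (e i)) (cscale I (c j) (e j)) = 0"
      using assms(2) by (simp add: cinner_cscale_left cinner_cscale_right)
    then show "inner (cscale I (c i) (e i)) (cscale I (c j) (e j)) = 0"
      by (metis Re_cinner zero_complex.sel(1))
  qed
  ultimately show ?thesis
    using norm_sum_Pythagorean[OF assms(1), of "\<lambda>i. cscale I (c i) (e i)"]
    by (simp add: norm_cscale power_mult_distrib)
qed

lemma expands_norm:
  assumes "finite B" "orthonormal_set B" "expands B f"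
  shows "(norm f)\<^sup>2 = (\<Sum>b\<in>B. (cmod (cinner I b f))\<^sup>2)"
  using norm_sum_orthonormal[of B "\<lambda>b. b" "\<lambda>b. cinner I b f"] assms
  by (simp add: expands_def orthonormal_set_def)

lemma expands_cinner:
  assumes "expands B f"
  shows "cinner I g f = (\<Sum>b\<in>B. cinner I g b * cinner I b f)"
proof -
  have "cinner I g f = cinner I g (\<Sum>b\<in>B. cscale I (cinner I b f) b)"
    using assms by (simp add: expands_def)
  then show ?thesis by (simp add: cinner_sum_right cinner_cscale_right mult.commute)
qed

text \<open>\<open>s\<close> is the orthogonal projection of \<open>f\<close>, so
  \<open>inner s f\<close> is the square of \<open>norm s\<close>, and Cauchy-Schwarz yields
  \<open>norm s \<le> norm f\<close>.\<close>

lemma bessel_finite: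
  assumes "finite K" "\<And>i j. i \<in> K \<Longrightarrow> j \<in> K \<Longrightarrow> cinner I (e i) (e j) = (if i = j then 1 else 0)"
  shows "(\<Sum>i\<in>K. (cmod (cinner I (e i) f))\<^sup>2) \<le> (norm f)\<^sup>2"
proof -
  define s where "s = (\<Sum>i\<in>K. cscale I (cinner I (e i) f) (e i))"
  have s: "(norm s)\<^sup>2 = (\<Sum>i\<in>K. (cmod (cinner I (e i) f))\<^sup>2)"
    unfolding s_def by (rule norm_sum_orthonormal[OF assms])
  have "cinner I s f = of_real (\<Sum>i\<in>K. (cmod (cinner I (e i) f))\<^sup>2)"
    unfolding s_def cinner_sum_left cinner_cscale_left
    by (simp add: mult.commute flip: complex_norm_square)
  then have "inner s f = (norm s)\<^sup>2" unfolding s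
    by (metis Re_cinner Re_complex_of_real)
  then have "norm s * norm s \<le> norm s * norm f"
    using norm_cauchy_schwarz[of s f] by (simp add: power2_eq_square)
  then have "norm s \<le> norm f"
    by (cases "norm s = 0") auto
  then show ?thesis unfolding s[symmetric] by (simp add: power_mono)
qed

lemma orthonormal_systemD:
  "orthonormal_system I e \<Longrightarrow> cinner I (e i) (e j) = (if i = j then 1 else 0)"
  by (simp add: orthonormal_system_def)

end

locale chilbert = cspace I for I :: "'a::{real_inner,complete_space} \<Rightarrow> 'a"
begin

lemma orthonormal_summable:
  assumes "orthonormal_system I e" "summable (\<lambda>j. (cmod (c j))\<^sup>2)"
  shows "summable (\<lambda>j. cscale I (c j) (e j))"
proof (rule orthogonal_summable)
  have n: "norm (e j) = 1" for j
    using orthonormal_systemD[OF assms(1), of j j]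
    by (simp add: norm_eq_1_iff_cinner)
  then show "summable (\<lambda>j. (norm (cscale I (c j) (e j)))\<^sup>2)"
    using assms(2) by (simp add: norm_cscale)
  fix i j :: nat assume "i \<noteq> j"
  then have "cinner I (cscale I (c i) (e i)) (cscale I (c j) (e j)) = 0"
    using orthonormal_systemD[OF assms(1), of i j] by (simp add: cinner_cscale_left cinner_cscale_right)
  then show "inner (cscale I (c i) (e i)) (cscale I (c j) (e j)) = 0"
    by (metis Re_cinner zero_complex.sel(1))
qed

text \<open>Bessel's inequality makes the series converge to some \<open>g\<close> with the same
  coefficients as \<open>f\<close>; completeness then forces \<open>f - g = 0\<close>.\<close>

lemma ONS_expansion:
  assumes "complete_ONS I e"
  shows "(\<lambda>j. cscale I (cinner I (e j) f) (e j)) sums f"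
proof -
  have e: "orthonormal_system I e" using assms by (simp add: complete_ONS_def)
  have "summable (\<lambda>j. (cmod (cinner I (e j) f))\<^sup>2)"
    by (rule summableI_nonneg_bounded[where x = "(norm f)\<^sup>2"])
       (auto intro!: bessel_finite simp: orthonormal_systemD[OF e])
  then obtain g where g: "(\<lambda>j. cscale I (cinner I (e j) f) (e j)) sums g"
    using orthonormal_summable[OF e] unfolding summable_def by metis
  have "cinner I (e i) g = cinner I (e i) f" for i
  proof -
    have "(\<lambda>j. cinner I (e i) (cscale I (cinner I (e j) f) (e j))) sums cinner I (e i) g"
      by (rule bounded_linear.sums[OF bounded_linear_cinner_right g])
    moreover have "(\<lambda>j. cinner I (e i) (cscale I (cinner I (e j) f) (e j)))
        = (\<lambda>j. if j = i then cinner I (e j) f else 0)"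
      by (auto simp: cinner_cscale_right orthonormal_systemD[OF e])
    moreover have "(\<lambda>j. if j = i then cinner I (e j) f else 0) sums cinner I (e i) f"
      by (rule sums_single)
    ultimately show ?thesis using sums_unique2 by metis
  qed
  then have "\<forall>j. cinner I (e j) (f - g) = 0" by (simp add: cinner_diff_right)
  then have "f - g = 0" using assms unfolding complete_ONS_def by blast
  then show ?thesis using g by simp
qed

lemma parseval:
  assumes "complete_ONS I e"
  shows "(\<lambda>j. (cmod (cinner I (e j) f))\<^sup>2) sums (norm f)\<^sup>2"
proof -
  have e: "orthonormal_system I e" using assms by (simp add: complete_ONS_def)
  have "(\<lambda>n. (norm (\<Sum>j<n. cscale I (cinner I (e j) f) (e j)))\<^sup>2) \<longlonglongrightarrow> (norm f)\<^sup>2"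
    using ONS_expansion[OF assms] unfolding sums_def by (intro tendsto_intros)
  then show ?thesis
    by (simp add: norm_sum_orthonormal orthonormal_systemD[OF e] sums_def)
qed

subsection \<open>Bounded operators and adjoints\<close>

lemma cboundedD:
  assumes "cbounded I A"
  shows "A (x + y) = A x + A y" "A (cscale I c x) = cscale I c (A x)" "bounded_linear A"
proof -
  show bl: "bounded_linear A" using assms by (simp add: cbounded_def)
  show "A (x + y) = A x + A y" by (rule linear_add[OF bounded_linear.linear[OF bl]])
  have "A (cscale I c x + 0) = cscale I c (A x) + A 0"
    using assms unfolding cbounded_def clinear_def by blast
  then show "A (cscale I c x) = cscale I c (A x)" 
    by (simp add: linear_0[OF bounded_linear.linear[OF bl]])
qed

lemma cboundedI:
  assumes "\<And>x y. A (x + y) = A x + A y" "\<And>c x. A (cscale I c x) = cscale I c (A x)"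
    and "\<And>x. norm (A x) \<le> norm x * K"
  shows "cbounded I A"
proof -
  have "A (r *\<^sub>R x) = r *\<^sub>R A x" for r x
    using assms(2)[of "of_real r" x] by simp
  then have "bounded_linear A" by (intro bounded_linear_intro[where K = K] assms)
  then show ?thesis by (simp add: cbounded_def clinear_def assms)
qed

lemma cbounded_ONS_sums:
  assumes "cbounded I A" "complete_ONS I e"
  shows "(\<lambda>j. cscale I (cinner I (e j) f) (A (e j))) sums A f"
  using bounded_linear.sums[OF cboundedD(3)[OF assms(1)] ONS_expansion[OF assms(2)], of f]
  by (simp add: cboundedD(2)[OF assms(1)])

text \<open>The description by \<open>THE\<close> has meaning only once an adjoint exists. The
  witness \<open>B x\<close> has the coefficients \<open>cinner I (A (e j)) x\<close>, which are
  square summable because \<open>A\<close> is Hilbert-Schmidt.\<close>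

lemma cadjoint_cinner:
  assumes "hilbert_schmidt I A" "complete_ONS I e"
  shows "cinner I (cadjoint I A x) y = cinner I x (A y)"
proof -
  have A: "cbounded I A" and sm: "summable (\<lambda>j. (norm (A (e j)))\<^sup>2)"
    using assms by (auto simp: hilbert_schmidt_def)
  have e: "orthonormal_system I e" using assms(2) by (simp add: complete_ONS_def)
  define B where "B x = (\<Sum>j. cscale I (cinner I (A (e j)) x) (e j))" for x
  have "cinner I (B x) y = cinner I x (A y)" for x y
  proof -
    have "summable (\<lambda>j. (norm x)\<^sup>2 * (norm (A (e j)))\<^sup>2)"
      using sm by (rule summable_mult)
    then have "summable (\<lambda>j. (cmod (cinner I (A (e j)) x))\<^sup>2)"
    proof (rule summable_comparison_test')
      show "norm ((cmod (cinner I (A (e j)) x))\<^sup>2) \<le> (norm x)\<^sup>2 * (norm (A (e j)))\<^sup>2" for j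
        using power_mono[OF cmod_cinner_le[of "A (e j)" x], of 2]
        by (simp add: power_mult_distrib mult.commute)
    qed
    then have "(\<lambda>j. cscale I (cinner I (A (e j)) x) (e j)) sums B x"
      unfolding B_def by (intro summable_sums orthonormal_summable[OF e])
    then have "(\<lambda>n. cinner I (\<Sum>j<n. cscale I (cinner I (A (e j)) x) (e j)) y) \<longlonglongrightarrow> cinner I (B x) y"
      unfolding sums_def by (rule tendsto_cinner_left)
    moreover have "(\<lambda>n. cinner I x (\<Sum>j<n. cscale I (cinner I (e j) y) (A (e j)))) \<longlonglongrightarrow> cinner I x (A y)"
      using cbounded_ONS_sums[OF A assms(2)] unfolding sums_def by (rule tendsto_cinner_right)
    moreover have "cinner I (\<Sum>j<n. cscale I (cinner I (A (e j)) x) (e j)) y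
        = cinner I x (\<Sum>j<n. cscale I (cinner I (e j) y) (A (e j)))" for n
      by (simp add: cinner_sum_left cinner_sum_right cinner_cscale_left cinner_cscale_right
          cinner_commute[of "A _" x] mult.commute)
    ultimately show ?thesis by (simp only: LIMSEQ_unique)
  qed
  then have "\<exists>!B. \<forall>x y. cinner I (B x) y = cinner I x (A y)"
    by (intro ex1I[of _ B]) (auto intro!: ext cinner_eqI_left)
  from theI'[OF this] show ?thesis unfolding cadjoint_def by blast
qed

text \<open>Boundedness comes from writing the squared norm of the image of \<open>x\<close> as its
  product with \<open>x\<close> through \<open>A\<close> and cancelling one factor. For summability,
  the matrix entries of the adjoint are the conjugates of those of \<open>A\<close>; finitely many
  columns are summed by Parseval, and Bessel bounds each resulting row by a term of the series of
  \<open>A\<close>.\<close>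

lemma hilbert_schmidt_cadjoint:
  assumes "hilbert_schmidt I A" "complete_ONS I e"
  shows "hilbert_schmidt I (cadjoint I A)"
proof -
  note adj = cadjoint_cinner[OF assms]
  have A: "cbounded I A" and sm: "\<And>e. complete_ONS I e \<Longrightarrow> summable (\<lambda>j. (norm (A (e j)))\<^sup>2)"
    using assms by (auto simp: hilbert_schmidt_def)
  have "cbounded I (cadjoint I A)"
  proof (rule cboundedI)
    show "cadjoint I A (x + y) = cadjoint I A x + cadjoint I A y" for x y
      by (rule cinner_eqI_left) (simp add: adj cinner_add_left)
    show "cadjoint I A (cscale I c x) = cscale I c (cadjoint I A x)" for c x
      by (rule cinner_eqI_left) (simp add: adj cinner_cscale_left)
    fix x
    have "norm (cadjoint I A x) * norm (cadjoint I A x) = inner x (A (cadjoint I A x))"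
      by (metis adj Re_cinner power2_eq_square power2_norm_eq_inner)
    also have "\<dots> \<le> norm x * norm (A (cadjoint I A x))" by (rule norm_cauchy_schwarz)
    also have "\<dots> \<le> norm x * (onorm A * norm (cadjoint I A x))"
      by (intro mult_left_mono onorm cboundedD(3)[OF A]) auto
    finally have "norm (cadjoint I A x) * norm (cadjoint I A x) \<le> (norm x * onorm A) * norm (cadjoint I A x)"
      by (simp add: mult.assoc)
    then show "norm (cadjoint I A x) \<le> norm x * onorm A"
      using onorm_pos_le[OF cboundedD(3)[OF A]] by (cases "cadjoint I A x = 0") auto
  qed
  moreover have "summable (\<lambda>k. (norm (cadjoint I A (u k)))\<^sup>2)" if u: "complete_ONS I u" for u
  proof (rule summableI_nonneg_bounded)
    have o: "orthonormal_system I u" using u by (simp add: complete_ONS_def)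
    fix n
    have "(\<lambda>j. \<Sum>k<n. (cmod (cinner I (u j) (cadjoint I A (u k))))\<^sup>2) sums (\<Sum>k<n. (norm (cadjoint I A (u k)))\<^sup>2)"
      by (intro sums_sum parseval u)
    moreover have "(\<Sum>k<n. (cmod (cinner I (u j) (cadjoint I A (u k))))\<^sup>2) \<le> (norm (A (u j)))\<^sup>2" for j
    proof -
      have "cmod (cinner I (u j) (cadjoint I A (u k))) = cmod (cinner I (u k) (A (u j)))" for k
        unfolding adj[of "u k" "u j", symmetric] cinner_commute[of "u j" "cadjoint I A (u k)"] by simp
      then show ?thesis using bessel_finite[of "{..<n}" u "A (u j)"] by (simp add: orthonormal_systemD[OF o])
    qed
    ultimately show "(\<Sum>k<n. (norm (cadjoint I A (u k)))\<^sup>2) \<le> (\<Sum>j. (norm (A (u j)))\<^sup>2)"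
      by (intro sums_le[OF _ _ summable_sums[OF sm[OF u]]])
  qed auto
  ultimately show ?thesis by (simp add: hilbert_schmidt_def)
qed

text \<open>The coefficients are those of the adjoint image of \<open>h\<close>, and
  \<open>x\<close> is its projection to the span of the \<open>e k\<close>. Then
  \<open>cinner I (A x) h\<close> is the squared norm of \<open>x\<close>, and one factor
  \<open>norm x\<close> cancels.\<close>

lemma onorm_frame_bound:
  assumes "cbounded I A" "orthonormal_system I e" "finite K"
  shows "(\<Sum>k\<in>K. (cmod (cinner I (A (e k)) h))\<^sup>2) \<le> (onorm A)\<^sup>2 * (norm h)\<^sup>2"
proof -
  define c where "c k = cinner I (A (e k)) h" for k
  define x where "x = (\<Sum>k\<in>K. cscale I (c k) (e k))"
  have bl: "bounded_linear A" by (rule cboundedD(3)[OF assms(1)])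
  have x: "(norm x)\<^sup>2 = (\<Sum>k\<in>K. (cmod (c k))\<^sup>2)"
    unfolding x_def using orthonormal_systemD[OF assms(2)] assms(3)
    by (intro norm_sum_orthonormal)
  have Ax: "A x = (\<Sum>k\<in>K. cscale I (c k) (A (e k)))"
    unfolding x_def linear_sum[OF bounded_linear.linear[OF bl]] by (simp add: cboundedD(2)[OF assms(1)])
  have "cinner I (A x) h = (\<Sum>k\<in>K. cnj (c k) * c k)"
    by (simp add: Ax cinner_sum_left cinner_cscale_left c_def)
  also have "\<dots> = of_real ((norm x)\<^sup>2)"
    unfolding x of_real_sum complex_norm_square by (simp add: mult.commute)
  finally have "norm x * norm x = cmod (cinner I (A x) h)"
    by (simp add: norm_mult power2_eq_square)
  also have "\<dots> \<le> norm (A x) * norm h" by (rule cmod_cinner_le)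
  also have "\<dots> \<le> onorm A * norm x * norm h"
    by (intro mult_right_mono onorm[OF bl]) auto
  finally have "norm x * norm x \<le> (onorm A * norm h) * norm x" by (simp add: algebra_simps)
  then have "norm x \<le> onorm A * norm h"
    using onorm_pos_le[OF bl] by (cases "x = 0") auto
  then have "(norm x)\<^sup>2 \<le> (onorm A * norm h)\<^sup>2" by (intro power_mono) auto
  then show ?thesis by (simp add: x c_def power_mult_distrib)
qed

end

section \<open>Conjugations and transposes\<close>

locale chilbert_conj = chilbert I for I :: "'a::{real_inner,complete_space} \<Rightarrow> 'a" +
  fixes J :: "'a \<Rightarrow> 'a"
  assumes conjugation: "conjugation I J"
begin

lemma J_J [simp]: "J (J f) = f"
  and cinner_J_J: "cinner I (J f) (J g) = cinner I g f"
  using conjugation by (auto simp: conjugation_def)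

lemma cinner_J_left: "cinner I (J f) g = cinner I (J g) f"
  using cinner_J_J[of f "J g"] by simp

lemma J_add: "J (f + g) = J f + J g"
proof -
  have "J (cscale I 1 f + g) = cscale I (cnj 1) (J f) + J g"
    using conjugation unfolding conjugation_def by blast
  then show ?thesis by simp
qed

lemma J_cscale: "J (cscale I c f) = cscale I (cnj c) (J f)"
proof -
  have "J 0 = 0" using J_add[of 0 0] by simp
  moreover have "J (cscale I c f + 0) = cscale I (cnj c) (J f) + J 0"
    using conjugation unfolding conjugation_def by blast
  ultimately show ?thesis by simp
qed

lemma norm_J [simp]: "norm (J f) = norm f"
proof -
  have "(norm (J f))\<^sup>2 = (norm f)\<^sup>2"
    by (metis Re_cinner cinner_J_J power2_norm_eq_inner)
  then show ?thesis by simp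
qed

lemma complete_ONS_J:
  assumes "complete_ONS I e"
  shows "complete_ONS I (\<lambda>j. J (e j))"
proof -
  have "f = 0" if "\<forall>j. cinner I (J (e j)) f = 0" for f
  proof -
    have "cinner I (e j) (J f) = 0" for j
      using that cinner_J_J[of "J (e j)" f] cinner_commute[of "J f" "e j"] cinner_commute[of f "J (e j)"]
      by (metis J_J cinner_J_left complex_cnj_zero)
    then have "J f = 0" using assms by (simp add: complete_ONS_def)
    then show "f = 0" by (metis norm_J norm_eq_zero)
  qed
  then show ?thesis
    using assms by (auto simp: complete_ONS_def orthonormal_system_def cinner_J_J)
qed

text \<open>The form \<open>cinner I (J x) y\<close> is bilinear and symmetric, and this is
  adjointness with respect to it. As a relation it treats \<open>A\<close> and \<open>T\<close>
  alike, so that one argument serves for both.\<close>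

definition transposed :: "('a \<Rightarrow> 'a) \<Rightarrow> ('a \<Rightarrow> 'a) \<Rightarrow> bool" where
  "transposed A T \<longleftrightarrow> (\<forall>x y. cinner I (J (A x)) y = cinner I (J x) (T y))"

lemma transposed_sym:
  assumes "transposed A T"
  shows "transposed T A"
  unfolding transposed_def
proof (intro allI)
  fix x y
  have "cinner I (J (T x)) y = cinner I (J y) (T x)" by (rule cinner_J_left)
  also have "\<dots> = cinner I (J (A y)) x" using assms by (simp only: transposed_def)
  also have "\<dots> = cinner I (J x) (A y)" by (rule cinner_J_left)
  finally show "cinner I (J (T x)) y = cinner I (J x) (A y)" .
qed

text \<open>The two antilinear factors make the composite linear, and \<open>J\<close> carries
  complete orthonormal systems to such systems.\<close>

lemma hilbert_schmidt_conj_op: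
  assumes "hilbert_schmidt I A"
  shows "hilbert_schmidt I (conj_op J A)"
proof -
  have A: "cbounded I A" using assms by (simp add: hilbert_schmidt_def)
  have "norm (A (J x)) \<le> norm x * onorm A" for x
    using onorm[OF cboundedD(3)[OF A], of "J x"] by (simp add: mult.commute)
  then have "cbounded I (conj_op J A)"
    by (intro cboundedI[where K = "onorm A"])
       (auto simp: conj_op_def J_add J_cscale cboundedD(1,2)[OF A])
  moreover have "summable (\<lambda>j. (norm (conj_op J A (e j)))\<^sup>2)" if "complete_ONS I e" for e
    using assms complete_ONS_J[OF that] by (auto simp: hilbert_schmidt_def conj_op_def)
  ultimately show ?thesis by (simp add: hilbert_schmidt_def)
qed

lemma transpose_op:
  assumes "hilbert_schmidt I A" "complete_ONS I e"
  shows "hilbert_schmidt I (transpose_op I J A)" "transposed A (transpose_op I J A)"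
proof -
  have B: "hilbert_schmidt I (conj_op J A)" by (rule hilbert_schmidt_conj_op[OF assms(1)])
  show "hilbert_schmidt I (transpose_op I J A)"
    unfolding transpose_op_def by (rule hilbert_schmidt_cadjoint[OF B assms(2)])
  have "cinner I (transpose_op I J A x) y = cinner I x (J (A (J y)))" for x y
    unfolding transpose_op_def cadjoint_cinner[OF B assms(2)] by (simp add: conj_op_def)
  then have "cinner I (J x) (transpose_op I J A y) = cinner I (J (A x)) y" for x y
    unfolding cinner_commute[of "J x" "transpose_op I J A y"] cinner_commute[of "J (A x)" y] by simp
  then show "transposed A (transpose_op I J A)" by (simp add: transposed_def)
qed

text \<open>This expands \<open>T f\<close> in the conjugate basis, with coefficients read off from
  \<open>A\<close>. The sum arises when \<open>ad f\<close> is contracted with the outer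
  annihilation operator of a term of \<open>Delta_on\<close>.\<close>

lemma transposed_ONS_sums:
  assumes "transposed A T" "complete_ONS I e"
  shows "(\<lambda>j. cscale I (cinner I (J (A (e j))) f) (J (e j))) sums T f"
  using ONS_expansion[OF complete_ONS_J[OF assms(2)], of "T f"]
    assms(1)[unfolded transposed_def]
  by (simp only: )

end

section \<open>Fock representations\<close>

locale fock = L: chilbert_conj IL J + F: chilbert IF
  for IL :: "'l::{real_inner,complete_space} \<Rightarrow> 'l" and J :: "'l \<Rightarrow> 'l"
    and IF :: "'f::{real_inner,complete_space} \<Rightarrow> 'f" +
  fixes D :: "'f set" and a ad :: "'l \<Rightarrow> 'f \<Rightarrow> 'f" and \<Omega> :: 'f
  assumes fock: "fock_rep IL J IF D a ad \<Omega>"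
begin

lemma D_csubspace: "csubspace IF D"
  and a_D: "\<Phi> \<in> D \<Longrightarrow> a f \<Phi> \<in> D"
  and ad_D: "\<Phi> \<in> D \<Longrightarrow> ad f \<Phi> \<in> D"
  and a_ad_clinear: "\<lbrakk>\<Phi> \<in> D; \<Psi> \<in> D\<rbrakk> \<Longrightarrow> a f (cscale IF c \<Phi> + \<Psi>) = cscale IF c (a f \<Phi>) + a f \<Psi>
      \<and> ad f (cscale IF c \<Phi> + \<Psi>) = cscale IF c (ad f \<Phi>) + ad f \<Psi>"
  and a_ad_clinear_arg: "\<Phi> \<in> D \<Longrightarrow> a (cscale IL c f + g) \<Phi> = cscale IF c (a f \<Phi>) + a g \<Phi>
      \<and> ad (cscale IL c f + g) \<Phi> = cscale IF c (ad f \<Phi>) + ad g \<Phi>"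
  and ad_commute: "\<Phi> \<in> D \<Longrightarrow> ad f (ad g \<Phi>) = ad g (ad f \<Phi>)"
  and ccr: "\<Phi> \<in> D \<Longrightarrow> a f (ad g \<Phi>) - ad g (a f \<Phi>) = cscale IF (cinner IL (J f) g) \<Phi>"
  and cinner_a: "\<lbrakk>\<Phi> \<in> D; \<Psi> \<in> D\<rbrakk> \<Longrightarrow> cinner IF (a f \<Phi>) \<Psi> = cinner IF \<Phi> (ad (J f) \<Psi>)"
  and vacuum: "\<Omega> \<in> D" "norm \<Omega> = 1" "a f \<Omega> = 0"
  and creation_total: "closure (cspan IF (\<Union>n. creation_vectors ad \<Omega> n)) = UNIV"
  and continuous_a: "continuous_on (n_particle IF ad \<Omega> n) (a f)"
  and continuous_ad: "continuous_on (n_particle IF ad \<Omega> n) (ad f)"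
  and a_sums: "\<Phi> \<in> D_alpha IF ad \<Omega> (1/2) \<Longrightarrow> (\<lambda>n. a f (component IF ad \<Omega> n \<Phi>)) sums a f \<Phi>"
  using fock unfolding fock_rep_def image_subset_iff by (blast | simp)+

lemma D_subspace: "F.C.subspace D"
proof -
  have "\<And>c x y. \<lbrakk>x \<in> D; y \<in> D\<rbrakk> \<Longrightarrow> cscale IF c x + y \<in> D" "0 \<in> D"
    using D_csubspace by (auto simp: csubspace_def)
  from this(2) this(1)[of _ _ 1] this(1)[of _ 0] show ?thesis
    by (intro F.C.subspaceI) auto
qed

lemmas D_closed = F.C.subspace_0[OF D_subspace] F.C.subspace_add[OF D_subspace]
  F.C.subspace_scale[OF D_subspace] F.C.subspace_sum[OF D_subspace] a_D ad_D vacuum(1)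

lemma a_0 [simp]: "a f 0 = 0" and ad_0 [simp]: "ad f 0 = 0"
  using a_ad_clinear[of 0 0 f 1] D_closed(1) by auto

lemma a_add: "\<lbrakk>\<Phi> \<in> D; \<Psi> \<in> D\<rbrakk> \<Longrightarrow> a f (\<Phi> + \<Psi>) = a f \<Phi> + a f \<Psi>"
  and ad_add: "\<lbrakk>\<Phi> \<in> D; \<Psi> \<in> D\<rbrakk> \<Longrightarrow> ad f (\<Phi> + \<Psi>) = ad f \<Phi> + ad f \<Psi>"
  using a_ad_clinear[of \<Phi> \<Psi> f 1] by auto

lemma a_cscale: "\<Phi> \<in> D \<Longrightarrow> a f (cscale IF c \<Phi>) = cscale IF c (a f \<Phi>)"
  and ad_cscale: "\<Phi> \<in> D \<Longrightarrow> ad f (cscale IF c \<Phi>) = cscale IF c (ad f \<Phi>)"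
  using a_ad_clinear[of \<Phi> 0 f c] D_closed(1) by auto

lemma a_0_arg [simp]: "\<Phi> \<in> D \<Longrightarrow> a 0 \<Phi> = 0" and ad_0_arg [simp]: "\<Phi> \<in> D \<Longrightarrow> ad 0 \<Phi> = 0"
  using a_ad_clinear_arg[of \<Phi> 1 0 0] by auto

lemma a_add_arg: "\<Phi> \<in> D \<Longrightarrow> a (f + g) \<Phi> = a f \<Phi> + a g \<Phi>"
  and ad_add_arg: "\<Phi> \<in> D \<Longrightarrow> ad (f + g) \<Phi> = ad f \<Phi> + ad g \<Phi>"
  using a_ad_clinear_arg[of \<Phi> 1 f g] by auto

lemma a_cscale_arg: "\<Phi> \<in> D \<Longrightarrow> a (cscale IL c f) \<Phi> = cscale IF c (a f \<Phi>)"
  and ad_cscale_arg: "\<Phi> \<in> D \<Longrightarrow> ad (cscale IL c f) \<Phi> = cscale IF c (ad f \<Phi>)"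
  using a_ad_clinear_arg[of \<Phi> c f 0] by auto

lemma a_sum_arg: "\<Phi> \<in> D \<Longrightarrow> a (sum f K) \<Phi> = (\<Sum>i\<in>K. a (f i) \<Phi>)"
  and ad_sum_arg: "\<Phi> \<in> D \<Longrightarrow> ad (sum f K) \<Phi> = (\<Sum>i\<in>K. ad (f i) \<Phi>)"
  by (induction K rule: infinite_finite_induct) (auto simp: a_add_arg ad_add_arg)

lemma a_ad: "\<Phi> \<in> D \<Longrightarrow> a f (ad g \<Phi>) = ad g (a f \<Phi>) + cscale IF (cinner IL (J f) g) \<Phi>"
  using ccr[of \<Phi> f g] by (simp add: algebra_simps)

lemma inner_a: "\<lbrakk>\<Phi> \<in> D; \<Psi> \<in> D\<rbrakk> \<Longrightarrow> inner (a f \<Phi>) \<Psi> = inner \<Phi> (ad (J f) \<Psi>)"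
  using cinner_a by (metis F.Re_cinner)

lemma inner_ad: "\<lbrakk>\<Phi> \<in> D; \<Psi> \<in> D\<rbrakk> \<Longrightarrow> inner \<Psi> (ad f \<Phi>) = inner (a (J f) \<Psi>) \<Phi>"
  by (simp add: inner_a)

section \<open>Algebraic particle subspaces\<close>

definition V :: "nat \<Rightarrow> 'f set" where
  "V n = cspan IF (creation_vectors ad \<Omega> n)"

text \<open>These closures are not known to lie in \<open>D\<close>; facts about them are obtained
  from \<open>V n\<close> by the continuity of \<open>a f\<close> and \<open>ad f\<close>.\<close>

abbreviation H :: "nat \<Rightarrow> 'f set" where
  "H n \<equiv> n_particle IF ad \<Omega> n"

lemma H_eq_closure: "H n = closure (V n)"
  by (simp add: n_particle_def V_def)

lemma V_subset_H: "V n \<subseteq> H n"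
  by (simp add: H_eq_closure closure_subset)

lemma V_subspace: "F.C.subspace (V n)"
  by (simp add: V_def F.cspan_eq F.C.subspace_span)

lemma foldr_ad_D: "foldr ad fs \<Omega> \<in> D"
  by (induction fs) (auto simp: D_closed)

lemma foldr_ad_V: "foldr ad fs \<Omega> \<in> V (length fs)"
  unfolding V_def F.cspan_eq by (rule F.C.span_base) (auto simp: creation_vectors_def)

text \<open>The predicate must cut out a complex subspace. Since the operators are known to be
  linear on \<open>D\<close>, the predicates about them carry the conjunct
  \<open>\<Phi> \<in> D\<close> through the induction.\<close>

lemma V_induct [consumes 1, case_names base subspace]:
  assumes "\<Phi> \<in> V n" "\<And>fs. length fs = n \<Longrightarrow> P (foldr ad fs \<Omega>)" "F.C.subspace {\<Phi>. P \<Phi>}"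
  shows "P \<Phi>"
  using assms(1) unfolding V_def F.cspan_eq
  by (rule F.C.span_induct) (use assms(2,3) in \<open>auto simp: creation_vectors_def\<close>)

lemma V_D: "\<Phi> \<in> V n \<Longrightarrow> \<Phi> \<in> D"
  by (induction rule: V_induct) (auto simp: foldr_ad_D D_subspace)

lemma V_ad:
  assumes "\<Phi> \<in> V n"
  shows "ad f \<Phi> \<in> V (Suc n)"
proof -
  have "\<Phi> \<in> D \<and> ad f \<Phi> \<in> V (Suc n)"
    using assms
  proof (induction rule: V_induct)
    case (base fs)
    then show ?case using foldr_ad_V[of "f # fs"] foldr_ad_D by simp
  next
    case subspace
    show ?case
      using F.C.subspace_add[OF V_subspace] F.C.subspace_scale[OF V_subspace] F.C.subspace_0[OF V_subspace]
      by (intro F.C.subspaceI) (auto simp: ad_add ad_cscale D_closed)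
  qed
  then show ?thesis ..
qed

lemma V_a:
  assumes "\<Phi> \<in> V n"
  shows "a f \<Phi> \<in> V (n - 1)"
proof -
  have *: "a f (foldr ad fs \<Omega>) \<in> V (length fs - 1)" for fs
  proof (induction fs)
    case Nil
    show ?case using F.C.subspace_0[OF V_subspace] by (simp add: vacuum)
  next
    case (Cons g fs)
    \<comment> \<open>For empty \<open>fs\<close> the subtraction is truncated and
      \<open>V_ad\<close> would give \<open>V 1\<close>; the vector is zero there because the vacuum
      is annihilated.\<close>
    have "ad g (a f (foldr ad fs \<Omega>)) \<in> V (length fs)"
    proof (cases fs)
      case Nil
      then show ?thesis using F.C.subspace_0[OF V_subspace] by (simp add: vacuum)
    next
      case (Cons h hs)
      then show ?thesis using V_ad[OF Cons.IH] by simp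
    qed
    then show ?case
      using foldr_ad_V[of fs] F.C.subspace_add[OF V_subspace] F.C.subspace_scale[OF V_subspace]
      by (simp add: a_ad foldr_ad_D)
  qed
  have "\<Phi> \<in> D \<and> a f \<Phi> \<in> V (n - 1)"
    using assms
  proof (induction rule: V_induct)
    case (base fs)
    then show ?case using *[of fs] foldr_ad_D by simp
  next
    case subspace
    show ?case
      using F.C.subspace_add[OF V_subspace] F.C.subspace_scale[OF V_subspace] F.C.subspace_0[OF V_subspace]
      by (intro F.C.subspaceI) (auto simp: a_add a_cscale D_closed)
  qed
  then show ?thesis ..
qed

lemma V_0:
  assumes "\<Phi> \<in> V 0"
  shows "a f \<Phi> = 0"
proof -
  have "\<Phi> \<in> D \<and> a f \<Phi> = 0"
    using assms
  proof (induction rule: V_induct)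
    case subspace
    show ?case by (intro F.C.subspaceI) (auto simp: a_add a_cscale D_closed)
  qed (auto simp: vacuum)
  then show ?thesis ..
qed

subsection \<open>The number operator of a finite set of modes\<close>

text \<open>For orthonormal \<open>B\<close> this is the second quantization of the projection onto
  the span of \<open>B\<close>. The conjugation appears because \<open>a\<close> is linear in its
  argument, so that \<open>a (J b)\<close> is the formal adjoint of \<open>ad b\<close>.\<close>

definition mode_number :: "'l set \<Rightarrow> 'f \<Rightarrow> 'f" where
  "mode_number B \<Phi> = (\<Sum>b\<in>B. ad b (a (J b) \<Phi>))"

text \<open>The commutator with \<open>ad f\<close> is \<open>ad\<close> of the projection of
  \<open>f\<close> to the modes, and the projection fixes \<open>f\<close>.\<close>

lemma mode_number_ad:
  assumes "L.expands B f" "\<Phi> \<in> D"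
  shows "mode_number B (ad f \<Phi>) = ad f (mode_number B \<Phi>) + ad f \<Phi>"
proof -
  have *: "ad f (sum g K) = (\<Sum>b\<in>K. ad f (g b))" if "\<And>b. g b \<in> D" for g :: "'l \<Rightarrow> 'f" and K
    by (induction K rule: infinite_finite_induct) (auto simp: ad_add D_closed that)
  have "ad f \<Phi> = (\<Sum>b\<in>B. cscale IF (cinner IL b f) (ad b \<Phi>))"
    using assms by (subst assms(1)[unfolded L.expands_def]) (simp add: ad_sum_arg ad_cscale_arg)
  moreover have "ad b (a (J b) (ad f \<Phi>)) = ad f (ad b (a (J b) \<Phi>)) + cscale IF (cinner IL b f) (ad b \<Phi>)" for b
    using assms(2) by (simp add: a_ad ad_add ad_cscale ad_commute D_closed)
  ultimately show ?thesis
    using assms(2) by (simp add: mode_number_def * sum.distrib D_closed)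
qed

lemma mode_number_foldr:
  "(\<And>f. f \<in> set fs \<Longrightarrow> L.expands B f) \<Longrightarrow>
    mode_number B (foldr ad fs \<Omega>) = real (length fs) *\<^sub>R foldr ad fs \<Omega>"
proof (induction fs)
  case Nil
  then show ?case by (simp add: mode_number_def vacuum)
next
  case (Cons f fs)
  have "mode_number B (ad f (foldr ad fs \<Omega>))
      = ad f (cscale IF (of_nat (length fs)) (foldr ad fs \<Omega>)) + ad f (foldr ad fs \<Omega>)"
    using Cons by (subst mode_number_ad) (auto simp: foldr_ad_D)
  also have "ad f (cscale IF (of_nat (length fs)) (foldr ad fs \<Omega>)) = real (length fs) *\<^sub>R ad f (foldr ad fs \<Omega>)"
    unfolding ad_cscale[OF foldr_ad_D] by simp
  finally show ?case by (simp add: algebra_simps)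
qed

text \<open>Different vectors involve different modes. Quantifying over every \<open>B\<close> that
  expands \<open>S\<close> makes the claim stable under sums, for which the two sets
  \<open>S\<close> are united.\<close>

lemma V_support:
  assumes "\<Phi> \<in> V n"
  shows "\<exists>S. finite S \<and> (\<forall>B. (\<forall>f\<in>S. L.expands B f) \<longrightarrow> mode_number B \<Phi> = real n *\<^sub>R \<Phi>)"
proof -
  let ?P = "\<lambda>\<Phi>. \<exists>S. finite S \<and> (\<forall>B. (\<forall>f\<in>S. L.expands B f) \<longrightarrow> mode_number B \<Phi> = real n *\<^sub>R \<Phi>)"
  have add: "mode_number B (\<Phi> + \<Psi>) = mode_number B \<Phi> + mode_number B \<Psi>" if "\<Phi> \<in> D" "\<Psi> \<in> D" for B \<Phi> \<Psi>
    using that by (simp add: mode_number_def a_add ad_add D_closed sum.distrib)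
  have scale: "mode_number B (cscale IF c \<Phi>) = cscale IF c (mode_number B \<Phi>)" if "\<Phi> \<in> D" for B \<Phi> c
    using that by (simp add: mode_number_def a_cscale ad_cscale D_closed F.C.scale_sum_right)
  have "\<Phi> \<in> D \<and> ?P \<Phi>"
    using assms
  proof (induction rule: V_induct)
    case (base fs)
    then show ?case using mode_number_foldr[of fs] foldr_ad_D by (auto intro!: exI[of _ "set fs"])
  next
    case subspace
    show ?case
    proof (rule F.C.subspaceI)
      show "0 \<in> {\<Phi>. \<Phi> \<in> D \<and> ?P \<Phi>}"
        by (auto simp: D_closed mode_number_def intro!: exI[of _ "{}"])
    next
      fix x y assume "x \<in> {\<Phi>. \<Phi> \<in> D \<and> ?P \<Phi>}" "y \<in> {\<Phi>. \<Phi> \<in> D \<and> ?P \<Phi>}"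
      then obtain S S' where "x \<in> D" "y \<in> D" "finite S" "finite S'"
        "\<forall>B. (\<forall>f\<in>S. L.expands B f) \<longrightarrow> mode_number B x = real n *\<^sub>R x"
        "\<forall>B. (\<forall>f\<in>S'. L.expands B f) \<longrightarrow> mode_number B y = real n *\<^sub>R y" by blast
      then show "x + y \<in> {\<Phi>. \<Phi> \<in> D \<and> ?P \<Phi>}"
        by (auto simp: D_closed add scaleR_add_right intro!: exI[of _ "S \<union> S'"])
    next
      fix c x assume "x \<in> {\<Phi>. \<Phi> \<in> D \<and> ?P \<Phi>}"
      then obtain S where S: "x \<in> D" "finite S"
        "\<forall>B. (\<forall>f\<in>S. L.expands B f) \<longrightarrow> mode_number B x = real n *\<^sub>R x" by blast
      moreover have "cscale IF c (real n *\<^sub>R x) = real n *\<^sub>R cscale IF c x"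
        by (rule linear_scale[OF bounded_linear.linear[OF F.bounded_linear_cscale_right]])
      ultimately show "cscale IF c x \<in> {\<Phi>. \<Phi> \<in> D \<and> ?P \<Phi>}"
        by (auto simp: D_closed scale intro!: exI[of _ S])
    qed
  qed
  then show ?thesis ..
qed

lemma inner_mode_number:
  assumes "\<Phi> \<in> D" "\<Psi> \<in> D"
  shows "inner \<Psi> (mode_number B \<Phi>) = (\<Sum>b\<in>B. inner (a (J b) \<Psi>) (a (J b) \<Phi>))"
  using assms by (simp add: mode_number_def inner_sum_right inner_ad D_closed)

text \<open>A symmetric operator has orthogonal eigenvectors for distinct eigenvalues; here it is
  the mode number of a \<open>B\<close> that covers both vectors.\<close>

lemma V_orthogonal:
  assumes "\<Phi> \<in> V n" "\<Psi> \<in> V m" "n \<noteq> m"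
  shows "inner \<Phi> \<Psi> = 0"
proof -
  obtain S S' where S: "finite S" "finite S'"
    and N: "\<And>B. (\<forall>f\<in>S. L.expands B f) \<Longrightarrow> mode_number B \<Phi> = real n *\<^sub>R \<Phi>"
      "\<And>B. (\<forall>f\<in>S'. L.expands B f) \<Longrightarrow> mode_number B \<Psi> = real m *\<^sub>R \<Psi>"
    using V_support[OF assms(1)] V_support[OF assms(2)] by blast
  obtain B where "\<And>f. f \<in> S \<union> S' \<Longrightarrow> L.expands B f"
    using L.gram_schmidt[of "S \<union> S'"] S by blast
  then have "mode_number B \<Phi> = real n *\<^sub>R \<Phi>" "mode_number B \<Psi> = real m *\<^sub>R \<Psi>" using N by auto
  moreover have "inner \<Psi> (mode_number B \<Phi>) = inner (mode_number B \<Psi>) \<Phi>"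
    unfolding inner_commute[of "mode_number B \<Psi>"] using assms(1,2)[THEN V_D]
    by (simp add: inner_mode_number inner_commute)
  ultimately have "real n * inner \<Psi> \<Phi> = real m * inner \<Psi> \<Phi>" by simp
  then show ?thesis using assms(3) by (simp add: inner_commute)
qed

text \<open>The sum is the expectation of the mode number in \<open>\<Phi>\<close>. The set
  \<open>S\<close> lets further one-particle vectors be expanded in the same
  \<open>B\<close>.\<close>

lemma V_total:
  assumes "\<Phi> \<in> V n" "finite S"
  obtains B where "finite B" "L.orthonormal_set B" "\<And>f. f \<in> S \<Longrightarrow> L.expands B f"
    "(\<Sum>b\<in>B. (norm (a (J b) \<Phi>))\<^sup>2) = real n * (norm \<Phi>)\<^sup>2"
proof -
  obtain S' where S': "finite S'" and N: "\<And>B. (\<forall>f\<in>S'. L.expands B f) \<Longrightarrow> mode_number B \<Phi> = real n *\<^sub>R \<Phi>"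
    using V_support[OF assms(1)] by blast
  obtain B where B: "finite B" "L.orthonormal_set B" "\<And>f. f \<in> S \<union> S' \<Longrightarrow> L.expands B f"
    using L.gram_schmidt[of "S \<union> S'"] S' assms(2) by (metis finite_UnI)
  have "(\<Sum>b\<in>B. (norm (a (J b) \<Phi>))\<^sup>2) = inner \<Phi> (mode_number B \<Phi>)"
    using assms(1)[THEN V_D] by (simp add: inner_mode_number power2_norm_eq_inner)
  also have "\<dots> = real n * (norm \<Phi>)\<^sup>2"
    using N B(3) by (simp add: power2_norm_eq_inner)
  finally show ?thesis using that B by blast
qed

subsection \<open>Norm estimates on finite particle vectors\<close>

text \<open>The one-particle inequality is applied coefficientwise: for each \<open>u\<close> in an
  orthonormal set of Fock vectors, the functional
  \<open>g \<mapsto> cinner IF u (a g \<Phi>)\<close> is represented on the relevant modes by a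
  vector \<open>h u\<close>. Summing over \<open>u\<close> restores the norms, and
  \<open>V_total\<close> evaluates the right-hand side.\<close>

lemma annihilation_frame_bound:
  assumes "\<Phi> \<in> V n" "finite K"
    and frame: "\<And>h. (\<Sum>k\<in>K. (cmod (cinner IL (J (g k)) h))\<^sup>2) \<le> C * (norm h)\<^sup>2"
  shows "(\<Sum>k\<in>K. (norm (a (g k) \<Phi>))\<^sup>2) \<le> C * real n * (norm \<Phi>)\<^sup>2"
proof -
  obtain B where B: "finite B" "L.orthonormal_set B" "\<And>f. f \<in> (\<lambda>k. J (g k)) ` K \<Longrightarrow> L.expands B f"
    and total: "(\<Sum>b\<in>B. (norm (a (J b) \<Phi>))\<^sup>2) = real n * (norm \<Phi>)\<^sup>2"
    using V_total[OF assms(1), of "(\<lambda>k. J (g k)) ` K"] assms(2) by blast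
  define v where "v b = a (J b) \<Phi>" for b
  \<comment> \<open>\<open>U\<close> expands all Fock vectors in play, so that their norms become
    sums over coefficients.\<close>
  obtain U where U: "finite U" "F.orthonormal_set U"
    and Uv: "\<And>b. b \<in> B \<Longrightarrow> F.expands U (v b)" and Uw: "\<And>k. k \<in> K \<Longrightarrow> F.expands U (a (g k) \<Phi>)"
  proof -
    obtain U where "finite U" "F.orthonormal_set U"
      "\<And>x. x \<in> v ` B \<union> (\<lambda>k. a (g k) \<Phi>) ` K \<Longrightarrow> F.expands U x"
      using F.gram_schmidt[of "v ` B \<union> (\<lambda>k. a (g k) \<Phi>) ` K"] B(1) assms(2) by blast
    then show ?thesis using that by blast
  qed
  define h where "h u = (\<Sum>b\<in>B. cscale IL (cinner IF u (v b)) b)" for u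
  have w: "cinner IF u (a (g k) \<Phi>) = cinner IL (J (g k)) (h u)" if "k \<in> K" for k u
  proof -
    have "J (g k) = (\<Sum>b\<in>B. cscale IL (cinner IL b (J (g k))) b)"
      using B(3)[of "J (g k)"] that by (simp add: L.expands_def)
    then have "J (J (g k)) = J (\<Sum>b\<in>B. cscale IL (cinner IL b (J (g k))) b)" by (rule arg_cong)
    \<comment> \<open>Antilinearity conjugates the coefficients, which exchanges the two entries of
      the scalar product.\<close>
    moreover have "J (\<Sum>b\<in>B'. cscale IL (cinner IL b (J (g k))) b)
        = (\<Sum>b\<in>B'. cscale IL (cinner IL (J (g k)) b) (J b))" for B'
    proof (induction B' rule: infinite_finite_induct)
      case (insert b B')
      then show ?case by (simp add: L.J_add L.J_cscale L.cinner_commute[of "J (g k)" b])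
    qed (use L.J_add[of 0 0] in auto)
    ultimately have "g k = (\<Sum>b\<in>B. cscale IL (cinner IL (J (g k)) b) (J b))" by simp
    then have "a (g k) \<Phi> = a (\<Sum>b\<in>B. cscale IL (cinner IL (J (g k)) b) (J b)) \<Phi>"
      by (rule arg_cong[where f = "\<lambda>g. a g \<Phi>"])
    also have "\<dots> = (\<Sum>b\<in>B. cscale IF (cinner IL (J (g k)) b) (v b))"
      using V_D[OF assms(1)] by (simp add: a_sum_arg a_cscale_arg v_def)
    finally have "a (g k) \<Phi> = (\<Sum>b\<in>B. cscale IF (cinner IL (J (g k)) b) (v b))" .
    then show ?thesis
      by (simp add: h_def F.cinner_sum_right F.cinner_cscale_right L.cinner_sum_right
          L.cinner_cscale_right mult.commute)
  qed
  have "(\<Sum>k\<in>K. (norm (a (g k) \<Phi>))\<^sup>2) = (\<Sum>k\<in>K. \<Sum>u\<in>U. (cmod (cinner IL (J (g k)) (h u)))\<^sup>2)"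
    using F.expands_norm[OF U Uw] w by (intro sum.cong) auto
  also have "\<dots> = (\<Sum>u\<in>U. \<Sum>k\<in>K. (cmod (cinner IL (J (g k)) (h u)))\<^sup>2)"
    by (rule sum.swap)
  also have "\<dots> \<le> (\<Sum>u\<in>U. C * (norm (h u))\<^sup>2)"
    by (intro sum_mono frame)
  also have "\<dots> = C * (\<Sum>u\<in>U. \<Sum>b\<in>B. (cmod (cinner IF u (v b)))\<^sup>2)"
    unfolding h_def using B(1,2)
    by (simp add: L.norm_sum_orthonormal L.orthonormal_set_def sum_distrib_left)
  also have "\<dots> = C * (\<Sum>b\<in>B. \<Sum>u\<in>U. (cmod (cinner IF u (v b)))\<^sup>2)"
    by (subst sum.swap) simp
  also have "\<dots> = C * (\<Sum>b\<in>B. (norm (v b))\<^sup>2)"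
    using F.expands_norm[OF U Uv] by simp
  finally show ?thesis using total by (simp add: v_def mult.assoc)
qed

lemma norm_a_le:
  assumes "\<Phi> \<in> V n"
  shows "(norm (a f \<Phi>))\<^sup>2 \<le> (norm f)\<^sup>2 * real n * (norm \<Phi>)\<^sup>2"
proof -
  have "(cmod (cinner IL (J f) h))\<^sup>2 \<le> (norm f)\<^sup>2 * (norm h)\<^sup>2" for h
    using power_mono[OF L.cmod_cinner_le[of "J f" h], of 2] by (simp add: power_mult_distrib)
  then show ?thesis
    using annihilation_frame_bound[OF assms, of "{()}" "\<lambda>_. f" "(norm f)\<^sup>2"] by simp
qed

lemma norm_ad_eq:
  assumes "\<Phi> \<in> D"
  shows "(norm (ad (J f) \<Phi>))\<^sup>2 = (norm (a f \<Phi>))\<^sup>2 + (norm f)\<^sup>2 * (norm \<Phi>)\<^sup>2"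
proof -
  have "(norm (ad (J f) \<Phi>))\<^sup>2 = inner (a f (ad (J f) \<Phi>)) \<Phi>"
    using inner_a[of "ad (J f) \<Phi>" \<Phi> f] assms by (simp add: power2_norm_eq_inner D_closed)
  also have "\<dots> = inner \<Phi> (ad (J f) (a f \<Phi>)) + inner \<Phi> (cscale IF (of_real ((norm f)\<^sup>2)) \<Phi>)"
    unfolding a_ad[OF assms] L.cinner_self by (simp add: inner_add_right inner_commute del: of_real_power)
  also have "inner \<Phi> (ad (J f) (a f \<Phi>)) = (norm (a f \<Phi>))\<^sup>2"
    using inner_a[of \<Phi> "a f \<Phi>" f] assms by (simp add: power2_norm_eq_inner D_closed)
  finally show ?thesis
    by (simp add: power2_norm_eq_inner del: of_real_power)
qed

text \<open>The form is the squared norm of the sum of the tensors of \<open>g j\<close> with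
  \<open>\<Psi> j\<close>. Expanding the \<open>g k\<close> in \<open>B\<close> writes it as a sum
  of squares, one for each mode.\<close>

lemma gram_form_nonneg:
  assumes "finite K"
  shows "(\<Sum>j\<in>K. \<Sum>k\<in>K. inner (\<Psi> j) (cscale IF (cinner IL (g j) (g k)) (\<Psi> k))) \<ge> 0"
proof -
  obtain B where B: "finite B" "\<And>f. f \<in> g ` K \<Longrightarrow> L.expands B f"
    using L.gram_schmidt[of "g ` K"] assms by blast
  define w where "w b j = cscale IF (cinner IL b (g j)) (\<Psi> j)" for b j
  have "cinner IF (\<Psi> j) (cscale IF (cinner IL (g j) (g k)) (\<Psi> k)) = (\<Sum>b\<in>B. cinner IF (w b j) (w b k))"
    if "k \<in> K" for j k
  proof -
    have "cinner IL (g j) (g k) = (\<Sum>b\<in>B. cnj (cinner IL b (g j)) * cinner IL b (g k))"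
      using L.expands_cinner[OF B(2), of "g k" "g j"] that by (simp add: L.cinner_commute[of "g j"])
    then show ?thesis
      by (simp add: w_def F.cinner_cscale_left F.cinner_cscale_right sum_distrib_right mult.assoc mult.left_commute)
  qed
  then have "inner (\<Psi> j) (cscale IF (cinner IL (g j) (g k)) (\<Psi> k)) = (\<Sum>b\<in>B. inner (w b j) (w b k))"
    if "k \<in> K" for j k using that by (metis (no_types, lifting) F.Re_cinner Re_sum sum.cong)
  then have "(\<Sum>j\<in>K. \<Sum>k\<in>K. inner (\<Psi> j) (cscale IF (cinner IL (g j) (g k)) (\<Psi> k)))
      = (\<Sum>j\<in>K. \<Sum>k\<in>K. \<Sum>b\<in>B. inner (w b j) (w b k))" by simp
  also have "\<dots> = (\<Sum>j\<in>K. \<Sum>b\<in>B. \<Sum>k\<in>K. inner (w b j) (w b k))"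
    by (intro sum.cong refl sum.swap)
  also have "\<dots> = (\<Sum>b\<in>B. \<Sum>j\<in>K. \<Sum>k\<in>K. inner (w b j) (w b k))"
    by (rule sum.swap)
  also have "\<dots> = (\<Sum>b\<in>B. inner (\<Sum>j\<in>K. w b j) (\<Sum>j\<in>K. w b j))"
    unfolding inner_sum_left inner_sum_right by (intro sum.cong refl sum.swap)
  finally show ?thesis by (simp add: sum_nonneg)
qed

lemma norm_sum_annihilation_le:
  assumes "finite K" "\<And>j. \<Psi> j \<in> D"
  shows "(norm (\<Sum>j\<in>K. a (g j) (\<Psi> j)))\<^sup>2
    \<le> (\<Sum>j\<in>K. \<Sum>k\<in>K. (norm (a (g k) (\<Psi> j)))\<^sup>2 + (norm (g k))\<^sup>2 * (norm (\<Psi> j))\<^sup>2)"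
proof -
  \<comment> \<open>Commuting the operators turns the product of the j-th and k-th terms into
    \<open>inner (u k j) (u j k)\<close> minus a Gram term. The indices are swapped between the
    factors, so the arithmetic-geometric bound sums to the squared norms of all
    \<open>u j k\<close>.\<close>
  define u where "u j k = ad (J (g k)) (\<Psi> j)" for j k
  have le: "inner (a (g j) (\<Psi> j)) (a (g k) (\<Psi> k))
      \<le> ((norm (u j k))\<^sup>2 + (norm (u k j))\<^sup>2) / 2 - inner (\<Psi> j) (cscale IF (cinner IL (g j) (g k)) (\<Psi> k))" for j k
  proof -
    have "inner (a (g j) (\<Psi> j)) (a (g k) (\<Psi> k)) = inner (\<Psi> j) (ad (J (g j)) (a (g k) (\<Psi> k)))"
      using assms(2) by (simp add: inner_a D_closed)
    also have "ad (J (g j)) (a (g k) (\<Psi> k)) = a (g k) (u k j) - cscale IF (cinner IL (g j) (g k)) (\<Psi> k)"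
      using a_ad[OF assms(2), of "g k" "J (g j)" k] by (simp add: u_def L.cinner_J_J)
    also have "inner (\<Psi> j) (a (g k) (u k j) - cscale IF (cinner IL (g j) (g k)) (\<Psi> k))
        = inner (u k j) (u j k) - inner (\<Psi> j) (cscale IF (cinner IL (g j) (g k)) (\<Psi> k))"
      using inner_a[of "u k j" "\<Psi> j" "g k"] assms(2)
      by (simp add: inner_diff_right inner_commute u_def D_closed)
    also have "inner (u k j) (u j k) \<le> ((norm (u j k))\<^sup>2 + (norm (u k j))\<^sup>2) / 2"
      using norm_cauchy_schwarz[of "u k j" "u j k"] sum_squares_bound[of "norm (u k j)" "norm (u j k)"]
      by (simp add: power2_eq_square)
    finally show ?thesis by simp
  qed
  have "(norm (\<Sum>j\<in>K. a (g j) (\<Psi> j)))\<^sup>2 = (\<Sum>j\<in>K. \<Sum>k\<in>K. inner (a (g j) (\<Psi> j)) (a (g k) (\<Psi> k)))"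
    unfolding power2_norm_eq_inner inner_sum_left inner_sum_right by (rule sum.swap)
  also have "\<dots> \<le> (\<Sum>j\<in>K. \<Sum>k\<in>K. ((norm (u j k))\<^sup>2 + (norm (u k j))\<^sup>2) / 2
      - inner (\<Psi> j) (cscale IF (cinner IL (g j) (g k)) (\<Psi> k)))"
    by (intro sum_mono le)
  also have "\<dots> \<le> (\<Sum>j\<in>K. \<Sum>k\<in>K. ((norm (u j k))\<^sup>2 + (norm (u k j))\<^sup>2) / 2)"
    using gram_form_nonneg[OF assms(1), of \<Psi> g] by (simp add: sum_subtractf)
  also have "\<dots> = ((\<Sum>j\<in>K. \<Sum>k\<in>K. (norm (u j k))\<^sup>2) + (\<Sum>j\<in>K. \<Sum>k\<in>K. (norm (u k j))\<^sup>2)) / 2"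
    by (simp add: sum.distrib flip: sum_divide_distrib)
  also have "(\<Sum>j\<in>K. \<Sum>k\<in>K. (norm (u k j))\<^sup>2) = (\<Sum>j\<in>K. \<Sum>k\<in>K. (norm (u j k))\<^sup>2)"
    by (rule sum.swap)
  finally show ?thesis using norm_ad_eq[OF assms(2)] by (simp add: u_def)
qed

text \<open>With an arbitrary index set the differences of partial sums have the same form, so one
  bound serves for the estimate and for the Cauchy property.\<close>

definition Delta_on :: "nat set \<Rightarrow> ('l \<Rightarrow> 'l) \<Rightarrow> (nat \<Rightarrow> 'l) \<Rightarrow> 'f \<Rightarrow> 'f" where
  "Delta_on K A e \<Phi> = (\<Sum>j\<in>K. a (A (e j)) (a (J (e j)) \<Phi>))"

text \<open>The annihilation bound is used twice: for the \<open>A (e k)\<close> on vectors with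
  \<open>n - 1\<close> particles, and for the \<open>J (e j)\<close> on \<open>\<Phi>\<close>, where
  Bessel's inequality supplies the constant 1.\<close>

lemma Delta_on_frame_bound_V:
  assumes "\<Phi> \<in> V n" "finite K" "orthonormal_system IL e"
    and frame: "\<And>h. (\<Sum>k\<in>K. (cmod (cinner IL (J (A (e k))) h))\<^sup>2) \<le> C * (norm h)\<^sup>2"
    and C: "C \<ge> 0"
  shows "(norm (Delta_on K A e \<Phi>))\<^sup>2
    \<le> (C * real (n - 1) + (\<Sum>k\<in>K. (norm (A (e k)))\<^sup>2)) * (real n * (norm \<Phi>)\<^sup>2)"
proof -
  let ?S = "\<Sum>k\<in>K. (norm (A (e k)))\<^sup>2"
  have D: "a (J (e j)) \<Phi> \<in> D" for j using assms(1) by (intro a_D V_D)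
  have ons: "(\<Sum>j\<in>K. (norm (a (J (e j)) \<Phi>))\<^sup>2) \<le> 1 * real n * (norm \<Phi>)\<^sup>2"
    using L.orthonormal_systemD[OF assms(3)] assms(2)
    by (intro annihilation_frame_bound[OF assms(1,2)]) (simp add: L.bessel_finite)
  have "(norm (Delta_on K A e \<Phi>))\<^sup>2 \<le> (\<Sum>j\<in>K. \<Sum>k\<in>K. (norm (a (A (e k)) (a (J (e j)) \<Phi>)))\<^sup>2
      + (norm (A (e k)))\<^sup>2 * (norm (a (J (e j)) \<Phi>))\<^sup>2)"
    unfolding Delta_on_def by (rule norm_sum_annihilation_le[OF assms(2) D])
  also have "\<dots> = (\<Sum>j\<in>K. (\<Sum>k\<in>K. (norm (a (A (e k)) (a (J (e j)) \<Phi>)))\<^sup>2)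
      + ?S * (norm (a (J (e j)) \<Phi>))\<^sup>2)"
    by (simp add: sum.distrib sum_distrib_right)
  also have "\<dots> \<le> (\<Sum>j\<in>K. C * real (n - 1) * (norm (a (J (e j)) \<Phi>))\<^sup>2 + ?S * (norm (a (J (e j)) \<Phi>))\<^sup>2)"
    by (intro sum_mono add_right_mono annihilation_frame_bound[OF V_a[OF assms(1)] assms(2) frame])
  also have "\<dots> = (C * real (n - 1) + ?S) * (\<Sum>j\<in>K. (norm (a (J (e j)) \<Phi>))\<^sup>2)"
    by (simp add: sum_distrib_left distrib_right)
  also have "\<dots> \<le> (C * real (n - 1) + ?S) * (real n * (norm \<Phi>)\<^sup>2)"
    using ons C by (intro mult_left_mono) (auto simp: sum_nonneg)
  finally show ?thesis .
qed

text \<open>The first bound takes \<open>C\<close> as the squared operator norm. The second takes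
  the sum over \<open>K\<close> itself, a Bessel constant by Cauchy-Schwarz in each term, so that
  the whole bound is proportional to it.\<close>

lemma Delta_on_bound_V:
  assumes "\<Phi> \<in> V n" "finite K" "orthonormal_system IL e"
  shows "cbounded IL A \<Longrightarrow> (norm (Delta_on K A e \<Phi>))\<^sup>2
      \<le> ((onorm A)\<^sup>2 * real (n - 1) + (\<Sum>k\<in>K. (norm (A (e k)))\<^sup>2)) * (real n * (norm \<Phi>)\<^sup>2)" (is "_ \<Longrightarrow> ?P")
    and "(norm (Delta_on K A e \<Phi>))\<^sup>2 \<le> (\<Sum>k\<in>K. (norm (A (e k)))\<^sup>2) * ((real n)\<^sup>2 * (norm \<Phi>)\<^sup>2)" (is ?Q)
proof -
  show ?P if "cbounded IL A"
  proof (rule Delta_on_frame_bound_V[OF assms])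
    fix h
    have "cmod (cinner IL (J (A (e k))) h) = cmod (cinner IL (A (e k)) (J h))" for k
      unfolding L.cinner_J_left[of _ h] L.cinner_commute[of "J h"] by simp
    then show "(\<Sum>k\<in>K. (cmod (cinner IL (J (A (e k))) h))\<^sup>2) \<le> (onorm A)\<^sup>2 * (norm h)\<^sup>2"
      using L.onorm_frame_bound[OF that assms(3,2), of "J h"] by simp
  qed simp
  let ?S = "\<Sum>k\<in>K. (norm (A (e k)))\<^sup>2"
  have "(norm (Delta_on K A e \<Phi>))\<^sup>2 \<le> (?S * real (n - 1) + ?S) * (real n * (norm \<Phi>)\<^sup>2)"
  proof (rule Delta_on_frame_bound_V[OF assms])
    fix h
    show "(\<Sum>k\<in>K. (cmod (cinner IL (J (A (e k))) h))\<^sup>2) \<le> ?S * (norm h)\<^sup>2"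
      unfolding sum_distrib_right
    proof (rule sum_mono)
      show "(cmod (cinner IL (J (A (e k))) h))\<^sup>2 \<le> (norm (A (e k)))\<^sup>2 * (norm h)\<^sup>2" for k
        using power_mono[OF L.cmod_cinner_le[of "J (A (e k))" h], of 2] by (simp add: power_mult_distrib)
    qed
  qed (simp add: sum_nonneg)
  \<comment> \<open>The case split resolves the truncated \<open>n - 1\<close>; for
    \<open>n = 0\<close> the factor \<open>real n\<close> makes both sides vanish.\<close>
  also have "\<dots> = ?S * ((real n)\<^sup>2 * (norm \<Phi>)\<^sup>2)"
    by (cases n) (simp_all add: power2_eq_square algebra_simps)
  finally show ?Q .
qed

subsection \<open>Closed particle subspaces and components\<close>

lemma H_approx:
  assumes "\<Phi> \<in> H n"
  obtains s where "\<And>k. s k \<in> V n" "s \<longlonglongrightarrow> \<Phi>"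
  using assms unfolding H_eq_closure closure_sequential by blast

lemma V_H: "\<Phi> \<in> V n \<Longrightarrow> \<Phi> \<in> H n"
  using V_subset_H by blast

lemma H_limit: "\<lbrakk>\<And>k. s k \<in> H n; s \<longlonglongrightarrow> \<Phi>\<rbrakk> \<Longrightarrow> \<Phi> \<in> H n"
  unfolding H_eq_closure using closed_sequentially[OF closed_closure] by blast

lemma H_subspace: "F.C.subspace (H n)"
proof (rule F.C.subspaceI)
  show "0 \<in> H n" using F.C.subspace_0[OF V_subspace] V_subset_H by blast
next
  fix x y assume "x \<in> H n" "y \<in> H n"
  then obtain s t where s: "\<And>k. s k \<in> V n" "s \<longlonglongrightarrow> x" and t: "\<And>k. t k \<in> V n" "t \<longlonglongrightarrow> y"
    by (metis H_approx)
  have "s k + t k \<in> H n" for k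
    using F.C.subspace_add[OF V_subspace s(1) t(1)] V_subset_H by blast
  then show "x + y \<in> H n" by (rule H_limit[OF _ tendsto_add[OF s(2) t(2)]])
next
  fix c x assume "x \<in> H n"
  then obtain s where s: "\<And>k. s k \<in> V n" "s \<longlonglongrightarrow> x" by (metis H_approx)
  have "cscale IF c (s k) \<in> H n" for k
    using F.C.subspace_scale[OF V_subspace s(1)] V_subset_H by blast
  then show "cscale IF c x \<in> H n"
    by (rule H_limit[OF _ bounded_linear.tendsto[OF F.bounded_linear_cscale_right s(2)]])
qed

lemma tendsto_a_H:
  "\<lbrakk>\<And>k. s k \<in> H n; s \<longlonglongrightarrow> \<Phi>\<rbrakk> \<Longrightarrow> (\<lambda>k. a f (s k)) \<longlonglongrightarrow> a f \<Phi>"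
  using continuous_on_tendsto_compose[OF continuous_a, of s \<Phi>] H_limit[of s n \<Phi>] by auto

lemma tendsto_ad_H:
  "\<lbrakk>\<And>k. s k \<in> H n; s \<longlonglongrightarrow> \<Phi>\<rbrakk> \<Longrightarrow> (\<lambda>k. ad f (s k)) \<longlonglongrightarrow> ad f \<Phi>"
  using continuous_on_tendsto_compose[OF continuous_ad, of s \<Phi>] H_limit[of s n \<Phi>] by auto

lemma a_H:
  assumes "\<Phi> \<in> H n"
  shows "a f \<Phi> \<in> H (n - 1)"
proof -
  obtain s where s: "\<And>k. s k \<in> V n" "s \<longlonglongrightarrow> \<Phi>" using H_approx[OF assms] by blast
  show ?thesis
    by (rule H_limit[OF V_H[OF V_a[OF s(1)]] tendsto_a_H[OF V_H[OF s(1)] s(2)]])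
qed

lemma a_H_0:
  assumes "\<Phi> \<in> H 0"
  shows "a f \<Phi> = 0"
proof -
  obtain s where s: "\<And>k. s k \<in> V 0" "s \<longlonglongrightarrow> \<Phi>" using H_approx[OF assms] by blast
  have "(\<lambda>k. a f (s k)) \<longlonglongrightarrow> a f \<Phi>" by (rule tendsto_a_H[OF V_H[OF s(1)] s(2)])
  then show ?thesis using V_0[OF s(1)] by (simp add: LIMSEQ_const_iff)
qed

text \<open>Linearity is given on \<open>D\<close>; on the closure it is inherited from
  approximating vectors in \<open>V n\<close>.\<close>

lemma a_H_diff:
  assumes "\<Phi> \<in> H n" "\<Psi> \<in> H n"
  shows "a f (\<Phi> - \<Psi>) = a f \<Phi> - a f \<Psi>"
proof -
  obtain s t where s: "\<And>k. s k \<in> V n" "s \<longlonglongrightarrow> \<Phi>" and t: "\<And>k. t k \<in> V n" "t \<longlonglongrightarrow> \<Psi>"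
    using assms by (metis H_approx)
  have V: "s k - t k \<in> V n" for k by (intro F.C.subspace_diff[OF V_subspace] s t)
  have "a f (s k - t k) = a f (s k) - a f (t k)" for k
    using a_add[of "s k - t k" "t k" f] V_D V t(1) by (metis add_diff_cancel_right' diff_add_cancel)
  moreover have "(\<lambda>k. a f (s k - t k)) \<longlonglongrightarrow> a f (\<Phi> - \<Psi>)"
    by (rule tendsto_a_H[OF V_H[OF V] tendsto_diff[OF s(2) t(2)]])
  moreover have "(\<lambda>k. a f (s k) - a f (t k)) \<longlonglongrightarrow> a f \<Phi> - a f \<Psi>"
    by (rule tendsto_diff[OF tendsto_a_H[OF V_H[OF s(1)] s(2)] tendsto_a_H[OF V_H[OF t(1)] t(2)]])
  ultimately show ?thesis by (simp only: LIMSEQ_unique)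
qed

lemma H_orthogonal:
  assumes "\<Phi> \<in> H n" "\<Psi> \<in> H m" "n \<noteq> m"
  shows "inner \<Phi> \<Psi> = 0"
proof -
  obtain s t where s: "\<And>k. s k \<in> V n" "s \<longlonglongrightarrow> \<Phi>" and t: "\<And>k. t k \<in> V m" "t \<longlonglongrightarrow> \<Psi>"
    using assms by (metis H_approx)
  have "(\<lambda>k. inner (s k) (t k)) \<longlonglongrightarrow> inner \<Phi> \<Psi>" by (intro tendsto_inner s t)
  then show ?thesis using V_orthogonal[OF s(1) t(1) assms(3)] by (simp add: LIMSEQ_const_iff)
qed

text \<open>A complex subspace is invariant under \<open>IF\<close>, so vanishing real parts against
  all of it force vanishing imaginary parts. Components can thus be treated with the real inner
  product.\<close>

lemma H_cinner_0_iff: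
  "(\<forall>\<Psi>\<in>H n. cinner IF \<Psi> \<Phi> = 0) \<longleftrightarrow> (\<forall>\<Psi>\<in>H n. inner \<Psi> \<Phi> = 0)"
proof
  assume *: "\<forall>\<Psi>\<in>H n. inner \<Psi> \<Phi> = 0"
  have "IF \<Psi> \<in> H n" if "\<Psi> \<in> H n" for \<Psi>
    using F.C.subspace_scale[OF H_subspace that, of \<i>] by (simp add: cscale_def)
  then show "\<forall>\<Psi>\<in>H n. cinner IF \<Psi> \<Phi> = 0" using * by (simp add: cinner_def complex_eq_iff)
next
  show "\<forall>\<Psi>\<in>H n. inner \<Psi> \<Phi> = 0" if "\<forall>\<Psi>\<in>H n. cinner IF \<Psi> \<Phi> = 0"
    using that by (metis F.Re_cinner zero_complex.sel(1))
qed

lemma component_eqI: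
  assumes "\<psi> \<in> H n" "\<And>\<Psi>. \<Psi> \<in> H n \<Longrightarrow> inner \<Psi> (\<Phi> - \<psi>) = 0"
  shows "component IF ad \<Omega> n \<Phi> = \<psi>"
  unfolding component_def H_cinner_0_iff
proof (rule the_equality)
  show "\<psi> \<in> H n \<and> (\<forall>\<Psi>\<in>H n. inner \<Psi> (\<Phi> - \<psi>) = 0)" using assms by blast
next
  fix \<psi>' assume *: "\<psi>' \<in> H n \<and> (\<forall>\<Psi>\<in>H n. inner \<Psi> (\<Phi> - \<psi>') = 0)"
  then have "\<psi> - \<psi>' \<in> H n" using F.C.subspace_diff[OF H_subspace] assms(1) by blast
  then have "inner (\<psi> - \<psi>') (\<Phi> - \<psi>') = 0" "inner (\<psi> - \<psi>') (\<Phi> - \<psi>) = 0" using * assms(2) by auto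
  then have "inner (\<psi> - \<psi>') (\<psi> - \<psi>') = 0" by (simp add: inner_diff_right)
  then show "\<psi>' = \<psi>" by simp
qed

text \<open>On a creation vector the projection is the vector itself or zero, according to its
  length. Linearity extends this to the span, and contractivity together with completeness extends
  it to the limit \<open>\<Phi>\<close>.\<close>

lemma component_exists:
  "\<exists>\<psi>\<in>H n. \<forall>\<Psi>\<in>H n. inner \<Psi> (\<Phi> - \<psi>) = 0"
proof -
  define Q where "Q y p \<longleftrightarrow> p \<in> V n \<and> (\<forall>z\<in>H n. inner z (y - p) = 0)" for y p
  have Q_add: "Q (x + y) (p + q)" if "Q x p" "Q y q" for x y p q
    using that F.C.subspace_add[OF V_subspace, of p n q]
    by (auto simp: Q_def inner_add_right inner_diff_right)
  have Q_scale: "Q (cscale IF c x) (cscale IF c p)" if "Q x p" for c x p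
  proof -
    have "inner z (cscale IF c x - cscale IF c p) = 0" if "z \<in> H n" for z
    proof -
      have "\<forall>z\<in>H n. inner z (x - p) = 0" using \<open>Q x p\<close> by (simp add: Q_def)
      then have "\<forall>z\<in>H n. cinner IF z (x - p) = 0" by (simp only: H_cinner_0_iff)
      then have "cinner IF z (cscale IF c (x - p)) = 0" using that by (simp add: F.cinner_cscale_right)
      then show ?thesis
        by (metis F.C.scale_right_diff_distrib F.Re_cinner zero_complex.sel(1))
    qed
    then show ?thesis using that F.C.subspace_scale[OF V_subspace] by (auto simp: Q_def)
  qed
  have ex: "\<exists>p. Q y p" if "y \<in> cspan IF (\<Union>n. creation_vectors ad \<Omega> n)" for y
    using that unfolding F.cspan_eq
  proof (induction rule: F.C.span_induct)
    case base
    show ?case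
    proof (rule F.C.subspaceI)
      show "0 \<in> {y. \<exists>p. Q y p}"
        using F.C.subspace_0[OF V_subspace] by (auto simp: Q_def intro!: exI[of _ 0])
    qed (use Q_add Q_scale in blast)+
  next
    case (step x)
    then obtain fs where x: "x = foldr ad fs \<Omega>" by (auto simp: creation_vectors_def)
    have xV: "x \<in> V (length fs)" unfolding x by (rule foldr_ad_V)
    show ?case
    proof (cases "length fs = n")
      case True
      then show ?thesis using xV by (auto simp: Q_def intro!: exI[of _ x])
    next
      case False
      then have "\<forall>z\<in>H n. inner z x = 0" using H_orthogonal xV V_subset_H by blast
      then show ?thesis
        using F.C.subspace_0[OF V_subspace] by (auto simp: Q_def intro!: exI[of _ 0])
    qed
  qed
  have "\<Phi> \<in> closure (cspan IF (\<Union>n. creation_vectors ad \<Omega> n))" using creation_total by simp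
  then obtain y where y: "\<And>k. y k \<in> cspan IF (\<Union>n. creation_vectors ad \<Omega> n)" "y \<longlonglongrightarrow> \<Phi>"
    unfolding closure_sequential by blast
  define p where "p k = (SOME p. Q (y k) p)" for k
  have p: "Q (y k) (p k)" for k unfolding p_def by (rule someI_ex[OF ex[OF y(1)]])
  \<comment> \<open>Contractivity: both residuals are orthogonal to \<open>p k - p l\<close>, so its
    squared norm equals its inner product with \<open>y k - y l\<close>.\<close>
  have "norm (p k - p l) \<le> norm (y k - y l)" for k l
  proof -
    let ?p = "p k - p l" and ?y = "y k - y l"
    have "?p \<in> H n" using p F.C.subspace_diff[OF V_subspace] V_subset_H unfolding Q_def by blast
    then have "inner ?p (y k - p k) = 0" "inner ?p (y l - p l) = 0" using p by (auto simp: Q_def)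
    then have "inner ?p ?p = inner ?p ?y" by (simp add: inner_diff_right)
    then have "norm ?p * norm ?p \<le> norm ?y * norm ?p"
      using norm_cauchy_schwarz[of ?p ?y] by (simp add: power2_norm_eq_inner[symmetric] power2_eq_square mult.commute)
    then show ?thesis by (cases "?p = 0") auto
  qed
  moreover have "Cauchy y" using y(2) by (rule LIMSEQ_imp_Cauchy)
  ultimately have "Cauchy p"
    unfolding Cauchy_iff by (meson le_less_trans)
  then obtain \<psi> where \<psi>: "p \<longlonglongrightarrow> \<psi>" using Cauchy_convergent convergent_def by blast
  have "\<psi> \<in> H n" using p by (intro H_limit[OF V_H \<psi>]) (simp add: Q_def)
  moreover have "inner z (\<Phi> - \<psi>) = 0" if "z \<in> H n" for z
  proof -
    have "(\<lambda>k. inner z (y k - p k)) \<longlonglongrightarrow> inner z (\<Phi> - \<psi>)"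
      by (intro tendsto_intros y \<psi>)
    then show ?thesis using p that by (simp add: Q_def LIMSEQ_const_iff)
  qed
  ultimately show ?thesis by blast
qed

lemma component_H: "component IF ad \<Omega> n \<Phi> \<in> H n"
  using component_exists component_eqI by metis

lemma component_sums:
  assumes "\<And>n. x n \<in> H n" "x sums \<Phi>"
  shows "component IF ad \<Omega> n \<Phi> = x n"
proof (rule component_eqI[OF assms(1)])
  fix z assume z: "z \<in> H n"
  have "(\<lambda>m. inner z (x m)) sums inner z \<Phi>"
    by (rule bounded_linear.sums[OF bounded_linear_inner_right assms(2)])
  moreover have "(\<lambda>m. inner z (x m)) = (\<lambda>m. if m = n then inner z (x m) else 0)"
    using H_orthogonal[OF z assms(1)] by auto
  moreover have "(\<lambda>m. if m = n then inner z (x m) else 0) sums inner z (x n)" by (rule sums_single)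
  ultimately have "inner z \<Phi> = inner z (x n)" by (simp add: sums_unique2)
  then show "inner z (\<Phi> - x n) = 0" by (simp add: inner_diff_right)
qed

section \<open>Domains and componentwise action\<close>

abbreviation comp :: "nat \<Rightarrow> 'f \<Rightarrow> 'f" where
  "comp \<equiv> component IF ad \<Omega>"

lemma D_half_iff: "\<Phi> \<in> D_alpha IF ad \<Omega> (1/2) \<longleftrightarrow> summable (\<lambda>n. (real n + 1) * (norm (comp n \<Phi>))\<^sup>2)"
  by (simp add: D_alpha_def)

lemma D_1_iff: "\<Phi> \<in> D_alpha IF ad \<Omega> 1 \<longleftrightarrow> summable (\<lambda>n. (real n + 1)\<^sup>2 * (norm (comp n \<Phi>))\<^sup>2)"
proof -
  have "(real n + 1) powr (2 * 1) = (real n + 1)\<^sup>2" for n by (simp add: powr_numeral)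
  then show ?thesis by (simp add: D_alpha_def)
qed

lemma D_1_summable:
  assumes "\<Phi> \<in> D_alpha IF ad \<Omega> 1" "\<And>n. \<bar>c n\<bar> \<le> (real n + 1)\<^sup>2"
  shows "summable (\<lambda>n. c n * (norm (comp n \<Phi>))\<^sup>2)"
  using assms(1) unfolding D_1_iff
  by (rule summable_comparison_test'[where N = 0]) (simp add: abs_mult assms(2) mult_right_mono)

lemma D_1_half:
  assumes "\<Phi> \<in> D_alpha IF ad \<Omega> 1"
  shows "\<Phi> \<in> D_alpha IF ad \<Omega> (1/2)"
  unfolding D_half_iff by (rule D_1_summable[OF assms]) (simp add: power2_eq_square)

text \<open>The number operators are infinite sums of vectors, so their convergence has to be
  secured before their norms can be computed. Orthogonality of the components reduces it to the
  scalar series.\<close>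

lemma weighted_number_sums:
  assumes "summable (\<lambda>n. (c n)\<^sup>2 * (norm (comp n \<Phi>))\<^sup>2)"
  shows "(\<lambda>n. (c n)\<^sup>2 * (norm (comp n \<Phi>))\<^sup>2) sums (norm (\<Sum>n. c n *\<^sub>R comp n \<Phi>))\<^sup>2"
proof -
  have orth: "inner (c i *\<^sub>R comp i \<Phi>) (c j *\<^sub>R comp j \<Phi>) = 0" if "i \<noteq> j" for i j
    using H_orthogonal[OF component_H component_H that] by simp
  have eq: "(\<lambda>n. (c n)\<^sup>2 * (norm (comp n \<Phi>))\<^sup>2) = (\<lambda>n. (norm (c n *\<^sub>R comp n \<Phi>))\<^sup>2)"
    by (simp add: power_mult_distrib)
  have "summable (\<lambda>n. c n *\<^sub>R comp n \<Phi>)"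
    by (rule orthogonal_summable[OF orth assms[unfolded eq]])
  then show ?thesis
    unfolding eq by (intro orthogonal_sums_norm[OF orth] summable_sums)
qed

lemma number_op_sums:
  assumes "\<Phi> \<in> D_alpha IF ad \<Omega> 1"
  shows "(\<lambda>n. (real n)\<^sup>2 * (norm (comp n \<Phi>))\<^sup>2) sums (norm (number_op IF ad \<Omega> \<Phi>))\<^sup>2"
  unfolding number_op_def
  by (intro weighted_number_sums D_1_summable[OF assms]) (simp add: power_mono)

lemma sqrt_number_op_sums:
  assumes "\<Phi> \<in> D_alpha IF ad \<Omega> 1"
  shows "(\<lambda>n. real n * (norm (comp n \<Phi>))\<^sup>2) sums (norm (sqrt_number_op IF ad \<Omega> \<Phi>))\<^sup>2"
proof -
  have "(\<lambda>n. (sqrt (real n))\<^sup>2 * (norm (comp n \<Phi>))\<^sup>2) sums (norm (sqrt_number_op IF ad \<Omega> \<Phi>))\<^sup>2"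
    unfolding sqrt_number_op_def
    by (intro weighted_number_sums D_1_summable[OF assms]) (simp add: power2_eq_square algebra_simps)
  then show ?thesis by simp
qed

lemma norm_a_le_H:
  assumes "\<Phi> \<in> H n"
  shows "(norm (a f \<Phi>))\<^sup>2 \<le> (norm f)\<^sup>2 * real n * (norm \<Phi>)\<^sup>2"
proof -
  obtain s where s: "\<And>k. s k \<in> V n" "s \<longlonglongrightarrow> \<Phi>" using H_approx[OF assms] by blast
  have "(\<lambda>k. (norm (a f (s k)))\<^sup>2) \<longlonglongrightarrow> (norm (a f \<Phi>))\<^sup>2"
    by (rule tendsto_power[OF tendsto_norm[OF tendsto_a_H[OF V_H[OF s(1)] s(2)]]])
  moreover have "(\<lambda>k. (norm f)\<^sup>2 * real n * (norm (s k))\<^sup>2) \<longlonglongrightarrow> (norm f)\<^sup>2 * real n * (norm \<Phi>)\<^sup>2"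
    by (intro tendsto_intros s)
  ultimately show ?thesis using norm_a_le[OF s(1)] by (intro LIMSEQ_le) auto
qed

text \<open>The term for zero particles vanishes; after the shift the n-th summand lies in
  \<open>H n\<close>, as the identification of components requires.\<close>

lemma a_sums_Suc:
  assumes "\<Phi> \<in> D_alpha IF ad \<Omega> (1/2)"
  shows "(\<lambda>n. a f (comp (Suc n) \<Phi>)) sums a f \<Phi>"
  using a_sums[OF assms, of f] a_H_0[OF component_H, of f \<Phi>] by (subst sums_Suc_iff) simp

lemma component_a:
  assumes "\<Phi> \<in> D_alpha IF ad \<Omega> (1/2)"
  shows "comp n (a f \<Phi>) = a f (comp (Suc n) \<Phi>)"
  by (rule component_sums[OF _ a_sums_Suc[OF assms]]) (use a_H[OF component_H, of f "Suc _"] in simp)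

text \<open>One annihilation costs half a power of the particle number: its norm bound contributes a
  factor \<open>n + 1\<close>, which the weight of the smaller domain absorbs. A second annihilation
  may then act componentwise.\<close>

lemma a_D_half:
  assumes "\<Phi> \<in> D_alpha IF ad \<Omega> 1"
  shows "a f \<Phi> \<in> D_alpha IF ad \<Omega> (1/2)"
  unfolding D_half_iff component_a[OF D_1_half[OF assms]]
proof (rule summable_comparison_test')
  show "summable (\<lambda>n. (norm f)\<^sup>2 * ((real (Suc n) + 1)\<^sup>2 * (norm (comp (Suc n) \<Phi>))\<^sup>2))"
    using assms unfolding D_1_iff by (intro summable_mult) (subst summable_Suc_iff)
  fix n
  have "(real n + 1) * (norm (a f (comp (Suc n) \<Phi>)))\<^sup>2
      \<le> (real n + 1) * ((norm f)\<^sup>2 * real (Suc n) * (norm (comp (Suc n) \<Phi>))\<^sup>2)"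
    by (intro mult_left_mono norm_a_le_H component_H) auto
  also have "\<dots> = (real n + 1)\<^sup>2 * ((norm f)\<^sup>2 * (norm (comp (Suc n) \<Phi>))\<^sup>2)"
    by (simp add: power2_eq_square algebra_simps)
  also have "\<dots> \<le> (real (Suc n) + 1)\<^sup>2 * ((norm f)\<^sup>2 * (norm (comp (Suc n) \<Phi>))\<^sup>2)"
    by (intro mult_right_mono power_mono) auto
  finally show "norm ((real n + 1) * (norm (a f (comp (Suc n) \<Phi>)))\<^sup>2)
      \<le> (norm f)\<^sup>2 * ((real (Suc n) + 1)\<^sup>2 * (norm (comp (Suc n) \<Phi>))\<^sup>2)"
    by (simp add: mult.left_commute)
qed

section \<open>Partial sums on closed particle spaces\<close>

lemma Delta_on_sums:
  assumes "\<Phi> \<in> D_alpha IF ad \<Omega> 1"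
  shows "(\<lambda>n. Delta_on K A e (comp (n + 2) \<Phi>)) sums Delta_on K A e \<Phi>"
proof -
  have "(\<lambda>n. a g (a f (comp (n + 2) \<Phi>))) sums a g (a f \<Phi>)" for f g
    using a_sums_Suc[OF a_D_half[OF assms]] by (simp add: component_a[OF D_1_half[OF assms]])
  then show ?thesis unfolding Delta_on_def by (intro sums_sum)
qed

lemma Delta_on_H:
  assumes "\<Phi> \<in> H n"
  shows "Delta_on K A e \<Phi> \<in> H (n - 2)"
  unfolding Delta_on_def
proof (rule F.C.subspace_sum[OF H_subspace])
  show "a (A (e j)) (a (J (e j)) \<Phi>) \<in> H (n - 2)" for j
    using a_H[OF a_H[OF assms]] by (simp add: numeral_2_eq_2)
qed

lemma Delta_on_H_diff:
  assumes "\<Phi> \<in> H n" "\<Psi> \<in> H n"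
  shows "Delta_on K A e (\<Phi> - \<Psi>) = Delta_on K A e \<Phi> - Delta_on K A e \<Psi>"
  by (simp add: Delta_on_def sum_subtractf a_H_diff[OF assms] a_H_diff[OF a_H[OF assms(1)] a_H[OF assms(2)]])

lemma Delta_on_bound_H:
  assumes "\<Phi> \<in> H n" "finite K" "orthonormal_system IL e"
  shows "cbounded IL A \<Longrightarrow> (norm (Delta_on K A e \<Phi>))\<^sup>2
      \<le> ((onorm A)\<^sup>2 * real (n - 1) + (\<Sum>k\<in>K. (norm (A (e k)))\<^sup>2)) * (real n * (norm \<Phi>)\<^sup>2)" (is "_ \<Longrightarrow> ?P")
    and "(norm (Delta_on K A e \<Phi>))\<^sup>2 \<le> (\<Sum>k\<in>K. (norm (A (e k)))\<^sup>2) * ((real n)\<^sup>2 * (norm \<Phi>)\<^sup>2)" (is ?Q)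
proof -
  obtain s where s: "\<And>k. s k \<in> V n" "s \<longlonglongrightarrow> \<Phi>" using H_approx[OF assms(1)] by blast
  have *: "(\<lambda>k. (norm (Delta_on K A e (s k)))\<^sup>2) \<longlonglongrightarrow> (norm (Delta_on K A e \<Phi>))\<^sup>2"
    unfolding Delta_on_def
  proof (intro tendsto_intros)
    have "(\<lambda>k. a (J (e j)) (s k)) \<longlonglongrightarrow> a (J (e j)) \<Phi>" for j
      by (rule tendsto_a_H[OF V_H[OF s(1)] s(2)])
    then show "(\<lambda>k. a (A (e j)) (a (J (e j)) (s k))) \<longlonglongrightarrow> a (A (e j)) (a (J (e j)) \<Phi>)" for j
      by (rule tendsto_a_H[OF V_H[OF V_a[OF s(1)]]])
  qed
  have lim: "(\<lambda>k. c * (d * (norm (s k))\<^sup>2)) \<longlonglongrightarrow> c * (d * (norm \<Phi>)\<^sup>2)" for c d :: real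
    by (intro tendsto_intros s)
  show ?P if "cbounded IL A"
    using Delta_on_bound_V(1)[OF s(1) assms(2,3) that] by (intro LIMSEQ_le[OF * lim]) auto
  show ?Q
    using Delta_on_bound_V(2)[OF s(1) assms(2,3)] by (intro LIMSEQ_le[OF * lim]) auto
qed

subsection \<open>Convergence and basis independence\<close>

text \<open>For fixed \<open>\<Phi>\<close> in \<open>V n\<close> the operator depends on its
  argument linearly and boundedly, so the one-particle expansions can be inserted in the
  limit.\<close>

lemma tendsto_a_arg:
  assumes "\<Phi> \<in> V n" "(g \<longlongrightarrow> h) G"
  shows "((\<lambda>m. a (g m) \<Phi>) \<longlongrightarrow> a h \<Phi>) G"
proof -
  note D = V_D[OF assms(1)]
  have "bounded_linear (\<lambda>f. a f \<Phi>)"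
  proof (rule bounded_linear_intro[where K = "sqrt (real n) * norm \<Phi>"])
    show "a (r *\<^sub>R f) \<Phi> = r *\<^sub>R a f \<Phi>" for r f
      using a_cscale_arg[OF D, of "of_real r" f] by simp
    have "(norm (a f \<Phi>))\<^sup>2 \<le> (norm f * (sqrt (real n) * norm \<Phi>))\<^sup>2" for f
      using norm_a_le[OF assms(1), of f] by (simp add: power_mult_distrib mult.assoc)
    then show "norm (a f \<Phi>) \<le> norm f * (sqrt (real n) * norm \<Phi>)" for f
      by (rule power2_le_imp_le) simp
  qed (rule a_add_arg[OF D])
  then show ?thesis using assms(2) by (rule bounded_linear.tendsto)
qed

text \<open>Moving \<open>ad f\<close> to the left contracts it once with the outer and once with
  the inner annihilation operator. The two sums are partial expansions of the transpose and of
  \<open>A\<close>, both applied to \<open>f\<close>.\<close>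

lemma Delta_on_ad:
  assumes "\<Phi> \<in> D"
  shows "Delta_on K A e (ad f \<Phi>) = ad f (Delta_on K A e \<Phi>)
    + a (\<Sum>j\<in>K. cscale IL (cinner IL (J (A (e j))) f) (J (e j))) \<Phi>
    + a (\<Sum>j\<in>K. cscale IL (cinner IL (e j) f) (A (e j))) \<Phi>"
proof -
  have ad_sum: "ad f (sum g K) = (\<Sum>b\<in>K. ad f (g b))" if "\<And>b. g b \<in> D" for g :: "nat \<Rightarrow> 'f"
    by (induction K rule: infinite_finite_induct) (auto simp: ad_add D_closed that)
  have "a (A (e j)) (a (J (e j)) (ad f \<Phi>)) = ad f (a (A (e j)) (a (J (e j)) \<Phi>))
      + cscale IF (cinner IL (J (A (e j))) f) (a (J (e j)) \<Phi>)
      + cscale IF (cinner IL (e j) f) (a (A (e j)) \<Phi>)" for j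
    using assms by (simp add: a_ad a_add a_cscale D_closed)
  then show ?thesis
    using assms by (simp add: Delta_on_def ad_sum D_closed sum.distrib a_sum_arg a_cscale_arg)
qed

lemma Delta_on_V:
  assumes "\<Phi> \<in> V n"
  shows "Delta_on K A e \<Phi> \<in> H (n - 2)"
  by (rule Delta_on_H[OF V_H[OF assms]])

text \<open>One \<open>v\<close> precedes all bases and serves \<open>A\<close> and \<open>T\<close>
  together, so the induction yields independence of the basis and symmetry at once: each creation
  operator adds only the term for \<open>T f + A f\<close>.\<close>

lemma Delta_creation_limit:
  assumes "hilbert_schmidt IL A" "hilbert_schmidt IL T" "L.transposed A T"
  shows "\<exists>v. \<forall>e. complete_ONS IL e \<longrightarrow>
    (\<lambda>M. Delta_on {..<M} A e (foldr ad fs \<Omega>)) \<longlonglongrightarrow> v \<and>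
    (\<lambda>M. Delta_on {..<M} T e (foldr ad fs \<Omega>)) \<longlonglongrightarrow> v"
proof (induction fs)
  case Nil
  show ?case by (auto simp: Delta_on_def vacuum)
next
  case (Cons f fs)
  let ?\<Phi> = "foldr ad fs \<Omega>"
  obtain v where v: "\<And>e. complete_ONS IL e \<Longrightarrow> (\<lambda>M. Delta_on {..<M} A e ?\<Phi>) \<longlonglongrightarrow> v"
    "\<And>e. complete_ONS IL e \<Longrightarrow> (\<lambda>M. Delta_on {..<M} T e ?\<Phi>) \<longlonglongrightarrow> v"
    using Cons.IH by blast
  \<comment> \<open>The pair is bound anew here so that the step can also be applied with
    \<open>A\<close> and \<open>T\<close> exchanged.\<close>
  have step: "(\<lambda>M. Delta_on {..<M} A e (ad f ?\<Phi>)) \<longlonglongrightarrow> ad f v + a (T f) ?\<Phi> + a (A f) ?\<Phi>"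
    if e: "complete_ONS IL e" and tr: "L.transposed A T" and A: "hilbert_schmidt IL A"
      and v: "(\<lambda>M. Delta_on {..<M} A e ?\<Phi>) \<longlonglongrightarrow> v" for e A T
    unfolding Delta_on_ad[OF foldr_ad_D]
  proof (intro tendsto_add)
    \<comment> \<open>All partial sums lie in one closed particle space, on which
      \<open>ad f\<close> is continuous.\<close>
    show "(\<lambda>M. ad f (Delta_on {..<M} A e ?\<Phi>)) \<longlonglongrightarrow> ad f v"
      by (rule tendsto_ad_H[OF Delta_on_V[OF foldr_ad_V] v])
    show "(\<lambda>M. a (\<Sum>j<M. cscale IL (cinner IL (J (A (e j))) f) (J (e j))) ?\<Phi>) \<longlonglongrightarrow> a (T f) ?\<Phi>"
      by (rule tendsto_a_arg[OF foldr_ad_V L.transposed_ONS_sums[OF tr e, unfolded sums_def]])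
    have "cbounded IL A" using A by (simp add: hilbert_schmidt_def)
    then show "(\<lambda>M. a (\<Sum>j<M. cscale IL (cinner IL (e j) f) (A (e j))) ?\<Phi>) \<longlonglongrightarrow> a (A f) ?\<Phi>"
      by (rule tendsto_a_arg[OF foldr_ad_V L.cbounded_ONS_sums[OF _ e, unfolded sums_def]])
  qed
  have "(\<lambda>M. Delta_on {..<M} A e (ad f ?\<Phi>)) \<longlonglongrightarrow> ad f v + a (T f) ?\<Phi> + a (A f) ?\<Phi>"
    "(\<lambda>M. Delta_on {..<M} T e (ad f ?\<Phi>)) \<longlonglongrightarrow> ad f v + a (T f) ?\<Phi> + a (A f) ?\<Phi>"
    if e: "complete_ONS IL e" for e
    using step[OF e assms(3,1) v(1)[OF e]] step[OF e L.transposed_sym[OF assms(3)] assms(2) v(2)[OF e]]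
    by (simp_all add: add.commute add.left_commute)
  then show ?case by (simp only: foldr.simps comp_apply) blast
qed

lemma Delta_V_limit:
  assumes "hilbert_schmidt IL A" "hilbert_schmidt IL T" "L.transposed A T" "\<Phi> \<in> V n"
  shows "\<exists>v. \<forall>e. complete_ONS IL e \<longrightarrow>
    (\<lambda>M. Delta_on {..<M} A e \<Phi>) \<longlonglongrightarrow> v \<and> (\<lambda>M. Delta_on {..<M} T e \<Phi>) \<longlonglongrightarrow> v"
proof -
  let ?P = "\<lambda>\<Phi> v. \<forall>e. complete_ONS IL e \<longrightarrow>
    (\<lambda>M. Delta_on {..<M} A e \<Phi>) \<longlonglongrightarrow> v \<and> (\<lambda>M. Delta_on {..<M} T e \<Phi>) \<longlonglongrightarrow> v"
  have add: "Delta_on K A e (\<Phi> + \<Psi>) = Delta_on K A e \<Phi> + Delta_on K A e \<Psi>" if "\<Phi> \<in> D" "\<Psi> \<in> D" for K A e \<Phi> \<Psi>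
    using that by (simp add: Delta_on_def a_add D_closed sum.distrib)
  have scale: "Delta_on K A e (cscale IF c \<Phi>) = cscale IF c (Delta_on K A e \<Phi>)" if "\<Phi> \<in> D" for K A e c \<Phi>
    using that by (simp add: Delta_on_def a_cscale D_closed F.C.scale_sum_right)
  have "\<Phi> \<in> D \<and> (\<exists>v. ?P \<Phi> v)"
    using assms(4)
  proof (induction rule: V_induct)
    case (base fs)
    show ?case using Delta_creation_limit[OF assms(1-3)] foldr_ad_D by simp
  next
    case subspace
    show ?case
    proof (rule F.C.subspaceI)
      show "0 \<in> {\<Phi>. \<Phi> \<in> D \<and> (\<exists>v. ?P \<Phi> v)}"
        by (auto simp: D_closed Delta_on_def intro!: exI[of _ 0])
    next
      fix x y assume "x \<in> {\<Phi>. \<Phi> \<in> D \<and> (\<exists>v. ?P \<Phi> v)}" "y \<in> {\<Phi>. \<Phi> \<in> D \<and> (\<exists>v. ?P \<Phi> v)}"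
      then obtain v w where *: "x \<in> D" "y \<in> D" "?P x v" "?P y w" by blast
      then have "?P (x + y) (v + w)" unfolding add[OF *(1,2)] by (auto intro!: tendsto_add)
      then show "x + y \<in> {\<Phi>. \<Phi> \<in> D \<and> (\<exists>v. ?P \<Phi> v)}" using * D_closed by blast
    next
      fix c x assume "x \<in> {\<Phi>. \<Phi> \<in> D \<and> (\<exists>v. ?P \<Phi> v)}"
      then obtain v where *: "x \<in> D" "?P x v" by blast
      then have "?P (cscale IF c x) (cscale IF c v)"
        unfolding scale[OF *(1)] by (auto intro!: bounded_linear.tendsto[OF F.bounded_linear_cscale_right])
      then show "cscale IF c x \<in> {\<Phi>. \<Phi> \<in> D \<and> (\<exists>v. ?P \<Phi> v)}" using * D_closed by blast
    qed
  qed
  then show ?thesis ..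
qed

lemma Delta_on_sum_sq:
  assumes "\<Phi> \<in> D_alpha IF ad \<Omega> 1"
  shows "(\<lambda>n. (norm (Delta_on K A e (comp (n + 2) \<Phi>)))\<^sup>2) sums (norm (Delta_on K A e \<Phi>))\<^sup>2"
proof (rule orthogonal_sums_norm[OF _ Delta_on_sums[OF assms]])
  show "inner (Delta_on K A e (comp (i + 2) \<Phi>)) (Delta_on K A e (comp (j + 2) \<Phi>)) = 0" if "i \<noteq> j" for i j
    using Delta_on_H[OF component_H, of K A e "i + 2" \<Phi>] Delta_on_H[OF component_H, of K A e "j + 2" \<Phi>] that
    by (intro H_orthogonal[of _ i _ j]) auto
qed

text \<open>The n-particle component of the result stems from component \<open>n + 2\<close> of
  \<open>\<Phi>\<close>, so the number series majorizes it after its first two nonnegative terms are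
  dropped.\<close>

lemma Delta_on_bound:
  assumes "\<Phi> \<in> D_alpha IF ad \<Omega> 1" "finite K" "orthonormal_system IL e"
  shows "cbounded IL A \<Longrightarrow> (norm (Delta_on K A e \<Phi>))\<^sup>2 \<le> (onorm A)\<^sup>2 * (norm (number_op IF ad \<Omega> \<Phi>))\<^sup>2
      + ((\<Sum>k\<in>K. (norm (A (e k)))\<^sup>2) - (onorm A)\<^sup>2) * (norm (sqrt_number_op IF ad \<Omega> \<Phi>))\<^sup>2" (is "_ \<Longrightarrow> ?P")
    and "(norm (Delta_on K A e \<Phi>))\<^sup>2
      \<le> (\<Sum>k\<in>K. (norm (A (e k)))\<^sup>2) * (norm (number_op IF ad \<Omega> \<Phi>))\<^sup>2" (is ?Q)
proof -
  let ?S = "\<Sum>k\<in>K. (norm (A (e k)))\<^sup>2"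
  let ?C = "(onorm A)\<^sup>2"
  let ?p = "\<lambda>n. (norm (comp n \<Phi>))\<^sup>2"
  note N = number_op_sums[OF assms(1)] sqrt_number_op_sums[OF assms(1)]
  show ?Q
    by (rule sums_shift2_le[OF sums_mult[OF N(1), of ?S] _ Delta_on_sum_sq[OF assms(1)]
          Delta_on_bound_H(2)[OF component_H assms(2,3)]]) (simp add: sum_nonneg)
  assume A: "cbounded IL A"
  \<comment> \<open>For finite \<open>K\<close> the difference \<open>?S - ?C\<close> may be
    negative; the right-hand form is termwise nonnegative, which dropping terms requires.\<close>
  have eq: "?C * ((real n)\<^sup>2 * ?p n) + (?S - ?C) * (real n * ?p n)
      = (?C * real (n - 1) + ?S) * (real n * ?p n)" for n
    by (cases n) (simp_all add: power2_eq_square algebra_simps)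
  have "(\<lambda>n. ?C * ((real n)\<^sup>2 * ?p n) + (?S - ?C) * (real n * ?p n)) sums
      (?C * (norm (number_op IF ad \<Omega> \<Phi>))\<^sup>2 + (?S - ?C) * (norm (sqrt_number_op IF ad \<Omega> \<Phi>))\<^sup>2)"
    by (intro sums_add sums_mult N)
  then have s: "(\<lambda>n. (?C * real (n - 1) + ?S) * (real n * ?p n)) sums
      (?C * (norm (number_op IF ad \<Omega> \<Phi>))\<^sup>2 + (?S - ?C) * (norm (sqrt_number_op IF ad \<Omega> \<Phi>))\<^sup>2)"
    unfolding eq .
  show ?P
    by (rule sums_shift2_le[OF s _ Delta_on_sum_sq[OF assms(1)]
          Delta_on_bound_H(1)[OF component_H assms(2,3) A]]) (simp add: sum_nonneg)
qed

lemma Delta_convergent: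
  assumes "\<Phi> \<in> D_alpha IF ad \<Omega> 1" "hilbert_schmidt IL A" "complete_ONS IL e"
  shows "convergent (\<lambda>M. Delta_on {..<M} A e \<Phi>)"
proof (rule Cauchy_convergent, rule CauchyI')
  fix \<epsilon> :: real assume \<epsilon>: "\<epsilon> > 0"
  let ?R = "(norm (number_op IF ad \<Omega> \<Phi>))\<^sup>2"
  have e: "orthonormal_system IL e" using assms(3) by (simp add: complete_ONS_def)
  \<comment> \<open>The added 1 permits division even if \<open>?R\<close> is zero.\<close>
  have R: "?R + 1 > 0" by (simp add: add_nonneg_pos)
  then have "\<epsilon>\<^sup>2 / (?R + 1) > 0" using \<epsilon> by simp
  moreover have "summable (\<lambda>j. (norm (A (e j)))\<^sup>2)"
    using assms(2,3) by (auto simp: hilbert_schmidt_def)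
  ultimately obtain N where N: "\<And>m n. m \<ge> N \<Longrightarrow> norm (\<Sum>j=m..<n. (norm (A (e j)))\<^sup>2) < \<epsilon>\<^sup>2 / (?R + 1)"
    unfolding summable_Cauchy by blast
  have "dist (Delta_on {..<m} A e \<Phi>) (Delta_on {..<n} A e \<Phi>) < \<epsilon>" if "m \<ge> N" "n > m" for m n
  proof -
    let ?s = "\<Sum>j=m..<n. (norm (A (e j)))\<^sup>2"
    have "Delta_on {..<n} A e \<Phi> - Delta_on {..<m} A e \<Phi> = Delta_on {m..<n} A e \<Phi>"
      using that unfolding Delta_on_def by (simp add: lessThan_atLeast0 sum_diff_nat_ivl)
    then have "(dist (Delta_on {..<m} A e \<Phi>) (Delta_on {..<n} A e \<Phi>))\<^sup>2 = (norm (Delta_on {m..<n} A e \<Phi>))\<^sup>2"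
      by (metis dist_commute dist_norm)
    also have "\<dots> \<le> ?s * ?R" by (rule Delta_on_bound(2)[OF assms(1) _ e]) simp
    also have "\<dots> \<le> ?s * (?R + 1)" by (intro mult_left_mono) (auto simp: sum_nonneg)
    also have "\<dots> < \<epsilon>\<^sup>2"
      using N[OF that(1), of n] R by (simp add: sum_nonneg pos_less_divide_eq)
    finally show ?thesis using \<epsilon> by (simp add: power_less_imp_less_base)
  qed
  then show "\<exists>M. \<forall>m\<ge>M. \<forall>n>m. dist (Delta_on {..<m} A e \<Phi>) (Delta_on {..<n} A e \<Phi>) < \<epsilon>" by blast
qed

text \<open>Comparing differences on the spans covers both a change of basis and a change from
  \<open>A\<close> to its transpose.\<close>

definition same_limit :: "('l \<Rightarrow> 'l) \<Rightarrow> (nat \<Rightarrow> 'l) \<Rightarrow> ('l \<Rightarrow> 'l) \<Rightarrow> (nat \<Rightarrow> 'l) \<Rightarrow> bool" where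
  "same_limit A e B u \<longleftrightarrow> (\<forall>n. \<forall>\<Phi>\<in>V n. (\<lambda>M. Delta_on {..<M} A e \<Phi> - Delta_on {..<M} B u \<Phi>) \<longlonglongrightarrow> 0)"

text \<open>The bound proportional to \<open>real n\<close> squared is uniform in \<open>M\<close>.
  It carries convergence from \<open>V n\<close> to \<open>H n\<close> by approximation, and then to
  the whole domain as a summable majorant over the components.\<close>

lemma Delta_difference_tendsto_0:
  assumes "hilbert_schmidt IL A" "complete_ONS IL e" "hilbert_schmidt IL B" "complete_ONS IL u"
    and "same_limit A e B u" and \<Phi>: "\<Phi> \<in> D_alpha IF ad \<Omega> 1"
  shows "(\<lambda>M. Delta_on {..<M} A e \<Phi> - Delta_on {..<M} B u \<Phi>) \<longlonglongrightarrow> 0"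
proof -
  define X where "X M \<Phi> = Delta_on {..<M} A e \<Phi> - Delta_on {..<M} B u \<Phi>" for M \<Phi>
  have ons: "orthonormal_system IL e" "orthonormal_system IL u"
    using assms(2,4) by (auto simp: complete_ONS_def)
  have sm: "summable (\<lambda>j. (norm (A (e j)))\<^sup>2)" "summable (\<lambda>j. (norm (B (u j)))\<^sup>2)"
    using assms(1-4) by (auto simp: hilbert_schmidt_def)
  \<comment> \<open>The factor 2 stems from bounding the square of a sum of two norms by twice the
    sum of their squares.\<close>
  define S where "S = 2 * ((\<Sum>j. (norm (A (e j)))\<^sup>2) + (\<Sum>j. (norm (B (u j)))\<^sup>2))"
  have S0: "S \<ge> 0" unfolding S_def using sm by (simp add: suminf_nonneg)
  have bound: "(norm (X M x))\<^sup>2 \<le> S * ((real n)\<^sup>2 * (norm x)\<^sup>2)" if "x \<in> H n" for M n x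
  proof -
    let ?x = "Delta_on {..<M} A e x" and ?y = "Delta_on {..<M} B u x"
    have "(norm (X M x))\<^sup>2 \<le> (norm ?x + norm ?y)\<^sup>2"
      unfolding X_def by (intro power_mono norm_triangle_ineq4) auto
    also have "\<dots> \<le> 2 * ((norm ?x)\<^sup>2 + (norm ?y)\<^sup>2)"
      using sum_squares_bound[of "norm ?x" "norm ?y"] by (simp add: power2_sum)
    also have "\<dots> \<le> 2 * ((\<Sum>j<M. (norm (A (e j)))\<^sup>2) * ((real n)\<^sup>2 * (norm x)\<^sup>2)
        + (\<Sum>j<M. (norm (B (u j)))\<^sup>2) * ((real n)\<^sup>2 * (norm x)\<^sup>2))"
      by (intro mult_left_mono add_mono Delta_on_bound_H(2)[OF that] ons) auto
    also have "\<dots> \<le> 2 * ((\<Sum>j. (norm (A (e j)))\<^sup>2) * ((real n)\<^sup>2 * (norm x)\<^sup>2)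
        + (\<Sum>j. (norm (B (u j)))\<^sup>2) * ((real n)\<^sup>2 * (norm x)\<^sup>2))"
      by (intro mult_left_mono add_mono mult_right_mono sum_le_suminf sm) auto
    finally show ?thesis by (simp add: S_def algebra_simps)
  qed
  have XH: "(\<lambda>M. X M x) \<longlonglongrightarrow> 0" if x: "x \<in> H n" for n x
  proof (rule metric_LIMSEQ_I)
    fix \<epsilon> :: real assume \<epsilon>: "\<epsilon> > 0"
    \<comment> \<open>\<open>sqrt S * real n\<close> bounds every \<open>X M\<close> on
      \<open>H n\<close>; the added 1 keeps the divisor of \<epsilon> positive.\<close>
    define c where "c = sqrt S * real n + 1"
    have c: "c > 0" unfolding c_def using S0 by (simp add: add_nonneg_pos)
    obtain s where s: "\<And>k. s k \<in> V n" "s \<longlonglongrightarrow> x" using H_approx[OF x] by blast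
    have "\<epsilon> / (2 * c) > 0" using \<epsilon> c by simp
    then obtain k where k: "norm (s k - x) < \<epsilon> / (2 * c)"
      using s(2) unfolding LIMSEQ_iff by blast
    let ?y = "s k"
    have y: "?y \<in> V n" by (rule s(1))
    have "(\<lambda>M. X M ?y) \<longlonglongrightarrow> 0" using assms(5) y unfolding same_limit_def X_def by blast
    then obtain M0 where M0: "\<And>M. M \<ge> M0 \<Longrightarrow> norm (X M ?y) < \<epsilon> / 2"
      using \<epsilon> unfolding LIMSEQ_iff by (metis diff_zero half_gt_zero)
    have "dist (X M x) 0 < \<epsilon>" if "M \<ge> M0" for M
    proof -
      have d: "X M (?y - x) = X M ?y - X M x"
        unfolding X_def using Delta_on_H_diff[OF V_H[OF y] x] by simp
      have "(norm (X M (?y - x)))\<^sup>2 \<le> (sqrt S * real n * norm (?y - x))\<^sup>2"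
        using bound[OF F.C.subspace_diff[OF H_subspace V_H[OF y] x], of M] S0
        by (simp add: power_mult_distrib mult.assoc)
      then have "norm (X M (?y - x)) \<le> sqrt S * real n * norm (?y - x)"
        by (rule power2_le_imp_le) (use S0 in simp)
      also have "\<dots> \<le> c * norm (?y - x)" by (intro mult_right_mono) (auto simp: c_def)
      also have "\<dots> < \<epsilon> / 2" using k c by (simp add: field_simps)
      finally have "norm (X M ?y - X M x) < \<epsilon> / 2" unfolding d .
      moreover have "norm (X M x) \<le> norm (X M ?y) + norm (X M ?y - X M x)"
        using norm_triangle_ineq4[of "X M ?y" "X M ?y - X M x"] by simp
      ultimately show ?thesis using M0[OF that] by simp
    qed
    then show "\<exists>M0. \<forall>M\<ge>M0. dist (X M x) 0 < \<epsilon>" by blast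
  qed
  let ?p = "\<lambda>m. comp (m + 2) \<Phi>"
  have "(\<lambda>m. X M (?p m)) sums X M \<Phi>" for M
    unfolding X_def by (intro sums_diff Delta_on_sums \<Phi>)
  moreover have "inner (X M (?p i)) (X M (?p j)) = 0" if "i \<noteq> j" for M i j
  proof -
    have "X M (?p m) \<in> H m" for m
      unfolding X_def using Delta_on_H[OF component_H, of _ _ _ "m + 2" \<Phi>]
      by (intro F.C.subspace_diff[OF H_subspace]) auto
    then show ?thesis using H_orthogonal that by blast
  qed
  ultimately have sq: "(\<lambda>m. (norm (X M (?p m)))\<^sup>2) sums (norm (X M \<Phi>))\<^sup>2" for M
    by (intro orthogonal_sums_norm)
  have "summable (\<lambda>n. (real n)\<^sup>2 * (norm (comp n \<Phi>))\<^sup>2)"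
    using number_op_sums[OF \<Phi>] by (rule sums_summable)
  then have "summable (\<lambda>m. (real (m + 2))\<^sup>2 * (norm (?p m))\<^sup>2)"
    by (subst summable_iff_shift)
  then have dom: "summable (\<lambda>m. S * ((real (m + 2))\<^sup>2 * (norm (?p m))\<^sup>2))"
    by (rule summable_mult)
  \<comment> \<open>Dominated convergence for series: each component tends to zero, under the
    majorant \<open>dom\<close>.\<close>
  have "(\<lambda>M. \<Sum>m. (norm (X M (?p m)))\<^sup>2) \<longlonglongrightarrow> (\<Sum>m. 0)"
  proof (rule conjunct2[OF conjunct2[OF tannerys_theorem[OF _ _ dom]]])
    show "(\<lambda>M. (norm (X M (?p m)))\<^sup>2) \<longlonglongrightarrow> 0" for m
      using tendsto_power[OF tendsto_norm[OF XH[OF component_H]], of "m + 2" \<Phi> 2] by simp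
    show "\<forall>\<^sub>F (m, M) in at_top \<times>\<^sub>F sequentially.
        norm ((norm (X M (?p m)))\<^sup>2) \<le> S * ((real (m + 2))\<^sup>2 * (norm (?p m))\<^sup>2)"
    proof (rule always_eventually, clarify)
      fix m M
      show "norm ((norm (X M (?p m)))\<^sup>2) \<le> S * ((real (m + 2))\<^sup>2 * (norm (?p m))\<^sup>2)"
        unfolding real_norm_def abs_power2 by (rule bound[OF component_H])
    qed
  qed simp
  then have "(\<lambda>M. (norm (X M \<Phi>))\<^sup>2) \<longlonglongrightarrow> 0" using sums_unique[OF sq] by simp
  then have "(\<lambda>M. sqrt ((norm (X M \<Phi>))\<^sup>2)) \<longlonglongrightarrow> sqrt 0" by (rule tendsto_real_sqrt)
  then have "(\<lambda>M. X M \<Phi>) \<longlonglongrightarrow> 0" by (simp add: tendsto_norm_zero_iff)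
  then show ?thesis by (simp add: X_def)
qed

text \<open>Convergence in a single basis suffices as input; other bases and the transpose follow
  from vanishing differences.\<close>

lemma Delta_limit:
  assumes "hilbert_schmidt IL A" "hilbert_schmidt IL T" "L.transposed A T"
    and "complete_ONS IL e" "complete_ONS IL u"
    and "\<Phi> \<in> D_alpha IF ad \<Omega> 1" "(\<lambda>M. Delta_on {..<M} A e \<Phi>) \<longlonglongrightarrow> v"
  shows "(\<lambda>M. Delta_on {..<M} A u \<Phi>) \<longlonglongrightarrow> v" "(\<lambda>M. Delta_on {..<M} T u \<Phi>) \<longlonglongrightarrow> v"
proof -
  have "(\<lambda>M. Delta_on {..<M} A e x - Delta_on {..<M} A u x) \<longlonglongrightarrow> 0"
    "(\<lambda>M. Delta_on {..<M} A e x - Delta_on {..<M} T u x) \<longlonglongrightarrow> 0" if x: "x \<in> V n" for x n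
  proof -
    obtain w where "(\<lambda>M. Delta_on {..<M} A e x) \<longlonglongrightarrow> w" "(\<lambda>M. Delta_on {..<M} A u x) \<longlonglongrightarrow> w"
      "(\<lambda>M. Delta_on {..<M} T u x) \<longlonglongrightarrow> w"
      using Delta_V_limit[OF assms(1-3) x] assms(4,5) by blast
    then show "(\<lambda>M. Delta_on {..<M} A e x - Delta_on {..<M} A u x) \<longlonglongrightarrow> 0"
      "(\<lambda>M. Delta_on {..<M} A e x - Delta_on {..<M} T u x) \<longlonglongrightarrow> 0"
      using tendsto_diff by force+
  qed
  then have "same_limit A e A u" "same_limit A e T u" by (auto simp: same_limit_def)
  then have "(\<lambda>M. Delta_on {..<M} A e \<Phi> - Delta_on {..<M} A u \<Phi>) \<longlonglongrightarrow> 0"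
    "(\<lambda>M. Delta_on {..<M} A e \<Phi> - Delta_on {..<M} T u \<Phi>) \<longlonglongrightarrow> 0"
    using Delta_difference_tendsto_0 assms by blast+
  then show "(\<lambda>M. Delta_on {..<M} A u \<Phi>) \<longlonglongrightarrow> v" "(\<lambda>M. Delta_on {..<M} T u \<Phi>) \<longlonglongrightarrow> v"
    using tendsto_diff[OF assms(7)] by fastforce+
qed

text \<open>Componentwise this is \<open>n \<le> n\<^sup>2\<close>. It makes the right-hand side of
  the estimate visibly nonnegative where the zero operator is chosen.\<close>

lemma sqrt_number_op_le:
  assumes "\<Phi> \<in> D_alpha IF ad \<Omega> 1"
  shows "(norm (sqrt_number_op IF ad \<Omega> \<Phi>))\<^sup>2 \<le> (norm (number_op IF ad \<Omega> \<Phi>))\<^sup>2"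
proof (rule sums_le[OF _ sqrt_number_op_sums[OF assms] number_op_sums[OF assms]])
  show "real n * (norm (comp n \<Phi>))\<^sup>2 \<le> (real n)\<^sup>2 * (norm (comp n \<Phi>))\<^sup>2" for n
    by (intro mult_right_mono) (cases n, auto simp: power2_eq_square)
qed

end

theorem theorem5p7:
  fixes IL :: "'l::{real_inner,complete_space} \<Rightarrow> 'l"
    and J :: "'l \<Rightarrow> 'l"
    and IF :: "'f::{real_inner,complete_space} \<Rightarrow> 'f"
    and D :: "'f set"
    and a ad :: "'l \<Rightarrow> 'f \<Rightarrow> 'f"
    and \<Omega> :: 'f
    and A :: "'l \<Rightarrow> 'l"
  assumes "complex_structure IL"
    and "separable_space (euclidean :: 'l topology)"
    and "infinite_dimensional IL"
    and "conjugation IL J"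
    and "complex_structure IF"
    and "fock_rep IL J IF D a ad \<Omega>"
    and "hilbert_schmidt IL A"
  shows "\<exists>\<Delta> :: 'f \<Rightarrow> 'f.
     (\<forall>e. complete_ONS IL e \<longrightarrow>
        (\<forall>\<Phi>\<in>D_alpha IF ad \<Omega> 1. (\<lambda>M. Delta_M J a A e M \<Phi>) \<longlonglongrightarrow> \<Delta> \<Phi>)) \<and>
     (\<forall>\<Phi>\<in>D_alpha IF ad \<Omega> 1.
        (norm (\<Delta> \<Phi>))\<^sup>2 \<le> (onorm A)\<^sup>2 * (norm (number_op IF ad \<Omega> \<Phi>))\<^sup>2
          + ((hs_norm IL A)\<^sup>2 - (onorm A)\<^sup>2) * (norm (sqrt_number_op IF ad \<Omega> \<Phi>))\<^sup>2) \<and>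
     (\<forall>e. complete_ONS IL e \<longrightarrow>
        (\<forall>\<Phi>\<in>D_alpha IF ad \<Omega> 1.
           (\<lambda>M. Delta_M J a (transpose_op IL J A) e M \<Phi>) \<longlonglongrightarrow> \<Delta> \<Phi>))"
proof -
  interpret fock IL J IF D a ad \<Omega>
    using assms by unfold_locales
  have Delta_M: "Delta_M J a B e M \<Phi> = Delta_on {..<M} B e \<Phi>" for B e M \<Phi>
    by (simp add: Delta_M_def Delta_on_def)
  show ?thesis
  proof (cases "\<exists>e. complete_ONS IL e")
    case False
    \<comment> \<open>This case does not occur, but the zero operator settles it without constructing a basis.\<close>
    have "0 \<le> (onorm A)\<^sup>2 * (norm (number_op IF ad \<Omega> \<Phi>))\<^sup>2
        + ((hs_norm IL A)\<^sup>2 - (onorm A)\<^sup>2) * (norm (sqrt_number_op IF ad \<Omega> \<Phi>))\<^sup>2"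
      if "\<Phi> \<in> D_alpha IF ad \<Omega> 1" for \<Phi>
    proof -
      have "0 \<le> (hs_norm IL A)\<^sup>2 * (norm (sqrt_number_op IF ad \<Omega> \<Phi>))\<^sup>2" by simp
      moreover have "(onorm A)\<^sup>2 * (norm (sqrt_number_op IF ad \<Omega> \<Phi>))\<^sup>2
          \<le> (onorm A)\<^sup>2 * (norm (number_op IF ad \<Omega> \<Phi>))\<^sup>2"
        by (intro mult_left_mono sqrt_number_op_le that) auto
      ultimately show ?thesis unfolding left_diff_distrib by linarith
    qed
    then show ?thesis using False by (intro exI[of _ "\<lambda>_. 0"]) auto
  next
    case True
    \<comment> \<open>This is the very system chosen in \<open>hs_norm\<close>, so the partial sums
      of squares converge to its square by definition.\<close>
    define u where "u = (SOME e. complete_ONS IL e)"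
    have u: "complete_ONS IL u" unfolding u_def using True by (rule someI_ex)
    have ou: "orthonormal_system IL u" using u by (simp add: complete_ONS_def)
    have A: "cbounded IL A" using assms(7) by (simp add: hilbert_schmidt_def)
    note T = L.transpose_op[OF assms(7) u]
    define \<Delta> where "\<Delta> \<Phi> = lim (\<lambda>M. Delta_on {..<M} A u \<Phi>)" for \<Phi>
    have lim: "(\<lambda>M. Delta_on {..<M} A u \<Phi>) \<longlonglongrightarrow> \<Delta> \<Phi>" if "\<Phi> \<in> D_alpha IF ad \<Omega> 1" for \<Phi>
      using Delta_convergent[OF that assms(7) u] unfolding \<Delta>_def by (simp add: convergent_LIMSEQ_iff)
    have sm: "summable (\<lambda>j. (norm (A (u j)))\<^sup>2)"
      using assms(7) u by (auto simp: hilbert_schmidt_def)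
    then have hs: "(\<lambda>M. \<Sum>j<M. (norm (A (u j)))\<^sup>2) \<longlonglongrightarrow> (hs_norm IL A)\<^sup>2"
      using summable_LIMSEQ[OF sm] by (simp add: hs_norm_def suminf_nonneg flip: u_def)
    have "(norm (\<Delta> \<Phi>))\<^sup>2 \<le> (onorm A)\<^sup>2 * (norm (number_op IF ad \<Omega> \<Phi>))\<^sup>2
        + ((hs_norm IL A)\<^sup>2 - (onorm A)\<^sup>2) * (norm (sqrt_number_op IF ad \<Omega> \<Phi>))\<^sup>2"
      if "\<Phi> \<in> D_alpha IF ad \<Omega> 1" for \<Phi>
    proof (rule LIMSEQ_le)
      show "(\<lambda>M. (norm (Delta_on {..<M} A u \<Phi>))\<^sup>2) \<longlonglongrightarrow> (norm (\<Delta> \<Phi>))\<^sup>2"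
        by (intro tendsto_power tendsto_norm lim that)
      show "(\<lambda>M. (onorm A)\<^sup>2 * (norm (number_op IF ad \<Omega> \<Phi>))\<^sup>2
          + ((\<Sum>j<M. (norm (A (u j)))\<^sup>2) - (onorm A)\<^sup>2) * (norm (sqrt_number_op IF ad \<Omega> \<Phi>))\<^sup>2)
        \<longlonglongrightarrow> (onorm A)\<^sup>2 * (norm (number_op IF ad \<Omega> \<Phi>))\<^sup>2
          + ((hs_norm IL A)\<^sup>2 - (onorm A)\<^sup>2) * (norm (sqrt_number_op IF ad \<Omega> \<Phi>))\<^sup>2"
        by (intro tendsto_add tendsto_const tendsto_mult tendsto_diff hs)
    qed (use Delta_on_bound(1)[OF that _ ou A] in auto)
    moreover have "(\<lambda>M. Delta_on {..<M} A e \<Phi>) \<longlonglongrightarrow> \<Delta> \<Phi>"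
      "(\<lambda>M. Delta_on {..<M} (transpose_op IL J A) e \<Phi>) \<longlonglongrightarrow> \<Delta> \<Phi>"
      if "complete_ONS IL e" "\<Phi> \<in> D_alpha IF ad \<Omega> 1" for e \<Phi>
      using Delta_limit[OF assms(7) T u that(1,2) lim[OF that(2)]] by auto
    ultimately show ?thesis unfolding Delta_M by (intro exI[of _ \<Delta>]) blast
  qed
qed

end
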